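(* Let $p$ be an odd prime, $m$ a positive integer, $q=p^m$, $u$ a positive integer and $v=\gcd(m,u)$. Let $\mathrm{Tr}$ denote the trace map from $\mathbb{F}_q$ to $\mathbb{F}_p$. Let \[ D_2=\{(x,y)\in\mathbb{F}_q^2\setminus\{(0,0)\} : \mathrm{Tr}(x^2+y^{p^u+1})=0\}, \] and $C_{D_2}=\{c(a,b)=(\mathrm{Tr}(ax+by))_{(x,y)\in D_2} : a,b\in\mathbb{F}_q\}$. If $\frac{m}{v}\equiv 0\pmod 4$, then $C_{D_2}$ is a $[p^{2m-1}+p^{m+v}-p^{m+v-1}-1,2m]$ three-weight linear code over $\mathbb{F}_p$ whose weight distribution is: weight $0$ with multiplicity $1$; weight $(p-1)p^{2m-2}$ with multiplicity $(p^{m-v}-1)(p^{m-v-1}+1)$; weight $(p-1)p^{2m-2}\left(1+\frac{p-1}{p^{m-v}}\right)$ with multiplicity $p^{2m}-p^{2m-2v}$; and weight $(p-1)p^{2m-2}\left(1+\frac{1}{p^{m-v-1}}\right)$ with multiplicity $(p^{m-v}-1)p^{m-v-1}(p-1)$.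
   Context: An $[n,k]$ linear code over $\mathbb{F}_p$ is a $k$-dimensional subspace of $\mathbb{F}_p^n$. The multiplicity of a weight $w$ is the number of codewords of Hamming weight $w$; a code is $t$-weight if exactly $t$ nonzero weights occur. *)

theory Defs
  imports Complex_Main "HOL-Computational_Algebra.Primes" "HOL-Library.FuncSet"
begin

text \<open>Finite field F_q is modelled as a finite field type 'a with CARD('a) = p^m.
  The absolute trace F_q -> F_p is Tr x = sum_{i<m} x^(p^i); its values lie in the
  prime subfield F_p of 'a, so codeword entries are taken in 'a.\<close>

definition trace :: "nat \<Rightarrow> nat \<Rightarrow> 'a::{finite,field} \<Rightarrow> 'a" where
  "trace p m x = (\<Sum>i<m. x ^ (p ^ i))"

definition D2 :: "nat \<Rightarrow> nat \<Rightarrow> nat \<Rightarrow> ('a::{finite,field} \<times> 'a) set" where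
  "D2 p m u = {(x, y). (x, y) \<noteq> (0, 0) \<and> trace p m (x ^ 2 + y ^ (p ^ u + 1)) = 0}"

definition codeword :: "nat \<Rightarrow> nat \<Rightarrow> ('a::{finite,field} \<times> 'a) set \<Rightarrow> 'a \<Rightarrow> 'a \<Rightarrow> ('a \<times> 'a \<Rightarrow> 'a)" where
  "codeword p m D a b = (\<lambda>z\<in>D. trace p m (a * fst z + b * snd z))"

definition code :: "nat \<Rightarrow> nat \<Rightarrow> ('a::{finite,field} \<times> 'a) set \<Rightarrow> ('a \<times> 'a \<Rightarrow> 'a) set" where
  "code p m D = {codeword p m D a b | a b. True}"

definition hamming_wt :: "('b set) \<Rightarrow> ('b \<Rightarrow> 'a::zero) \<Rightarrow> nat" where
  "hamming_wt D c = card {z \<in> D. c z \<noteq> 0}"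

end

theory Submission
  imports Defs "HOL-Library.Product_Plus" "HOL-Number_Theory.Pocklington"
    "HOL-Computational_Algebra.Polynomial"
begin

text \<open>
  Write \<open>\<sigma> y = y^(p^u)\<close> and \<open>Q(x, y) = Tr(x\<^sup>2 + y \<sigma> y)\<close>, a quadratic form over the prime field with polar form
  \<open>B\<close>.  Its radical consists of the \<open>(0, y)\<close> with \<open>\<sigma>(\<sigma> y) = -y\<close> and has \<open>p^(2v)\<close> elements.  Since \<open>4\<close> divides
  \<open>m/v\<close>, there is an \<open>\<alpha>\<close> with \<open>(2 \<alpha> \<sigma> \<alpha>)\<^sup>2 = -1\<close>, and from it one writes down a totally isotropic subspace
  with \<open>p^(m+v)\<close> elements that is its own orthogonal complement; this determines the number of
  solutions of \<open>Q = c\<close> for all \<open>c\<close> by elementary counting, without Gauss sums.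
  The weight of the codeword of a linear functional \<open>l\<close> then depends on whether \<open>l\<close> is nonzero on the
  radical, or \<open>l = B(n, _)\<close> with \<open>Q n = 0\<close>, or \<open>l = B(n, _)\<close> with \<open>Q n \<noteq> 0\<close>.
\<close>

section \<open>Quadratic forms over a finite subfield\<close>

text \<open>Over the prime field the form modulo its radical has dimension
  \<open>2 * m - 2 * v\<close>. The isotropic subspace \<open>U\<close>, being its own orthogonal
  complement, contains the radical, and its quotient has dimension \<open>m - v\<close>, exactly
  half. So the form is hyperbolic modulo the radical, and every coset of \<open>U\<close> has a
  known value distribution.

  The obstacle is to exhibit \<open>U\<close>. Three elements must be suitable powers in the field:
  \<open>-1\<close> for the radical to have full size, \<open>-1/4\<close> for
  \<open>\<alpha>\<close> to exist, and a square root of \<open>-1\<close> for the enlargement of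
  the graph, which alone is too small by the factor \<open>p^v\<close>. All three criteria come from
  the factors of \<open>p^(4v) - 1\<close>; this, besides making \<open>u / v\<close> odd, is how
  the condition on \<open>m / v\<close> enters.

  The counting always shifts along a line. In an isotropic direction \<open>n\<close> the form is
  affine in the parameter, so one solution per line can be read off. In an anisotropic direction it
  is truly quadratic and the count would depend on which elements are squares; an extra coordinate
  restores an isotropic direction.\<close>

locale subfield_space =
  fixes F :: "'a::field set" and scale :: "'a \<Rightarrow> 'v::{finite,ab_group_add} \<Rightarrow> 'v"
  assumes finite_F: "finite F" and zero_F: "0 \<in> F" and one_F: "1 \<in> F"
    and diff_F: "\<And>s t. s \<in> F \<Longrightarrow> t \<in> F \<Longrightarrow> s - t \<in> F"
    and mult_F: "\<And>s t. s \<in> F \<Longrightarrow> t \<in> F \<Longrightarrow> s * t \<in> F"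
    and divide_F: "\<And>s t. s \<in> F \<Longrightarrow> t \<in> F \<Longrightarrow> s / t \<in> F"
    and scale_add: "\<And>s t z. scale (s + t) z = scale s z + scale t z"
begin

lemma scale_0 [simp]: "scale 0 z = 0"
  using scale_add[of 0 0 z] by simp

lemma scale_minus: "scale (- s) z = - scale s z"
  using scale_add[of s "- s" z] by (simp add: eq_neg_iff_add_eq_0 add.commute)

lemma minus_F: "s \<in> F \<Longrightarrow> - s \<in> F"
  using diff_F[OF zero_F] by simp

lemma add_F: "s \<in> F \<Longrightarrow> t \<in> F \<Longrightarrow> s + t \<in> F"
  using diff_F[of s "- t"] minus_F by simp

definition subspace :: "'v set \<Rightarrow> bool" where
  "subspace W \<longleftrightarrow> 0 \<in> W \<and> (\<forall>x\<in>W. \<forall>y\<in>W. x + y \<in> W) \<and> (\<forall>s\<in>F. \<forall>x\<in>W. scale s x \<in> W)"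

definition functional :: "('v \<Rightarrow> 'a) \<Rightarrow> bool" where
  "functional h \<longleftrightarrow> (\<forall>z. h z \<in> F) \<and> (\<forall>y z. h (y + z) = h y + h z) \<and>
     (\<forall>s\<in>F. \<forall>z. h (scale s z) = s * h z)"

lemma subspace_UNIV: "subspace UNIV"
  by (simp add: subspace_def)

text \<open>Counts the pairs \<open>(s, z)\<close> related by \<open>R\<close> in two ways. In the
  applications \<open>R s z\<close> says that \<open>z\<close>, shifted by \<open>s\<close> times a
  fixed vector, solves an equation: every line carries one solution, so \<open>a = 1\<close>, and
  undoing the shift shows that \<open>b\<close> does not depend on \<open>s\<close>.\<close>

lemma card_double_count:
  assumes "finite A"
    and "\<And>z. z \<in> A \<Longrightarrow> card {s \<in> F. R s z} = a"
    and "\<And>s. s \<in> F \<Longrightarrow> card {z \<in> A. R s z} = b"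
  shows "card A * a = card F * b"
proof -
  have "(\<Sum>s\<in>F. card {z\<in>A. R s z}) = a * card A"
    by (rule sum_multicount) (use assms finite_F in auto)
  moreover have "(\<Sum>s\<in>F. card {z\<in>A. R s z}) = card F * b"
    using assms(3) by simp
  ultimately show ?thesis by (simp add: mult.commute)
qed

lemma card_affine_solution:
  assumes "a \<in> F" "b \<in> F" "a \<noteq> 0"
  shows "card {s \<in> F. b + s * a = 0} = 1"
proof -
  have "{s \<in> F. b + s * a = 0} = {- b / a}"
  proof -
    have "- b / a \<in> F"
      using assms divide_F minus_F by blast
    moreover have "s = - b / a" if "b + s * a = 0" for s
      using that assms by (simp add: field_simps eq_neg_iff_add_eq_0)
    ultimately show ?thesis
      using assms by auto
  qed
  then show ?thesis by simp
qed

text \<open>Along the direction \<open>w\<close> the functional \<open>h\<close> is affine with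
  nonzero slope, so each line in that direction meets the fibre exactly once.\<close>

lemma card_functional_fibre:
  assumes "functional h" "subspace W" "w \<in> W" "h w \<noteq> 0" "t \<in> F"
  shows "card F * card {z \<in> W. h z = t} = card W"
proof -
  have h: "h z \<in> F" "h (y + z) = h y + h z" "s \<in> F \<Longrightarrow> h (scale s z) = s * h z" for y z s
    using assms(1) by (auto simp: functional_def)
  have "card W * 1 = card F * card {z \<in> W. h z = t}"
  proof (rule card_double_count)
    show "card {s \<in> F. h (z + scale s w) = t} = 1" if "z \<in> W" for z
    proof -
      have "{s \<in> F. h (z + scale s w) = t} = {s \<in> F. (h z - t) + s * h w = 0}"
        using h by (auto simp: algebra_simps)
      then show ?thesis
        using card_affine_solution[of "h w" "h z - t"] h assms diff_F by simp
    qed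
    show "card {z \<in> W. h (z + scale s w) = t} = card {z \<in> W. h z = t}" if "s \<in> F" for s
    proof (rule bij_betw_same_card[of "\<lambda>z. z + scale s w"], rule bij_betw_byWitness[of _ "\<lambda>z. z - scale s w"])
      have "scale s w \<in> W" "- scale s w \<in> W"
        using that assms minus_F scale_minus[of s w] unfolding subspace_def by (auto, metis)
      then show "(\<lambda>z. z + scale s w) ` {z \<in> W. h (z + scale s w) = t} \<subseteq> {z \<in> W. h z = t}"
        "(\<lambda>z. z - scale s w) ` {z \<in> W. h z = t} \<subseteq> {z \<in> W. h (z + scale s w) = t}"
        using assms(2) unfolding subspace_def
        by (auto simp: diff_conv_add_uminus simp del: add_uminus_conv_diff)
    qed auto
  qed auto
  then show ?thesis by simp
qed

text \<open>The same line argument for a set that need only be stable under shifts by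
  \<open>r\<close>; it serves for the zero set of a quadratic form and a vector \<open>r\<close> of
  its radical.\<close>

lemma card_functional_zeros_translate:
  assumes h: "functional h" and r: "h r \<noteq> 0"
    and A: "\<And>s z. s \<in> F \<Longrightarrow> z \<in> A \<Longrightarrow> z + scale s r \<in> A"
  shows "card F * card {z \<in> A. h z = 0} = card A"
proof -
  have h': "h z \<in> F" "h (y + z) = h y + h z" "s \<in> F \<Longrightarrow> h (scale s z) = s * h z" for y z s
    using h by (auto simp: functional_def)
  have "card A * 1 = card F * card {z \<in> A. h z = 0}"
  proof (rule card_double_count)
    show "card {s \<in> F. h (z + scale s r) = 0} = 1" for z
    proof -
      have "{s \<in> F. h (z + scale s r) = 0} = {s \<in> F. h z + s * h r = 0}"
        using h' by auto
      then show ?thesis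
        using card_affine_solution[of "h r" "h z"] h' r by simp
    qed
    show "card {z \<in> A. h (z + scale s r) = 0} = card {z \<in> A. h z = 0}" if s: "s \<in> F" for s
    proof (rule bij_betw_same_card[of "\<lambda>z. z + scale s r"], rule bij_betw_byWitness[of _ "\<lambda>z. z - scale s r"])
      have "z - scale s r \<in> A" if "z \<in> A" for z
        using A[OF minus_F[OF s] that] scale_minus[of s r] by simp
      then show "(\<lambda>z. z + scale s r) ` {z \<in> A. h (z + scale s r) = 0} \<subseteq> {z \<in> A. h z = 0}"
        "(\<lambda>z. z - scale s r) ` {z \<in> A. h z = 0} \<subseteq> {z \<in> A. h (z + scale s r) = 0}"
        using A s by auto
    qed auto
  qed auto
  then show ?thesis by simp
qed

end

locale quadratic_space = subfield_space F scale
  for F :: "'a::field set" and scale :: "'a \<Rightarrow> 'v::{finite,ab_group_add} \<Rightarrow> 'v" +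
  fixes Q :: "'v \<Rightarrow> 'a" and B :: "'v \<Rightarrow> 'v \<Rightarrow> 'a"
  assumes two_nonzero: "(2::'a) \<noteq> 0"
    and Q_F: "Q z \<in> F"
    and Q_add: "Q (y + z) = Q y + Q z + B y z"
    and Q_scale: "s \<in> F \<Longrightarrow> Q (scale s z) = s ^ 2 * Q z"
    and B_functional: "functional (B y)"
    and B_same: "B z z = 2 * Q z"
begin

lemma B_F: "B y z \<in> F" and B_add: "B y (z + z') = B y z + B y z'"
  and B_scale: "s \<in> F \<Longrightarrow> B y (scale s z) = s * B y z"
  using B_functional[of y] by (auto simp: functional_def)

lemma B_commute: "B y z = B z y"
  using Q_add[of y z] Q_add[of z y] by (simp add: add.commute)

lemma Q_add_scale: "s \<in> F \<Longrightarrow> Q (z + scale s y) = Q z + s * B y z + s ^ 2 * Q y"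
  using Q_add[of z "scale s y"] B_scale[of s z y] by (simp add: B_commute[of y z] Q_scale)

text \<open>For \<open>z \<notin> U\<close> the form restricted to the coset \<open>z + U\<close> is a nonconstant affine function,
  so it takes every value equally often.\<close>

lemma card_level_isotropic:
  assumes U: "subspace U" and isotropic: "\<And>w. w \<in> U \<Longrightarrow> Q w = 0"
    and self_perp: "\<And>z. (\<And>w. w \<in> U \<Longrightarrow> B z w = 0) \<Longrightarrow> z \<in> U"
    and c: "c \<in> F"
  shows "card F * card {z. Q z = c} + card U
       = card (UNIV :: 'v set) + (if c = 0 then card F * card U else 0)"
proof -
  have U_pos: "card U > 0"
    using U by (auto simp: subspace_def card_gt_0_iff)
  have eq_inside: "card {w \<in> U. Q (z + w) = c} = (if c = 0 then card U else 0)" if "z \<in> U" for z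
  proof -
    have "Q (z + w) = 0" if "w \<in> U" for w
      using U \<open>z \<in> U\<close> that isotropic by (simp add: subspace_def)
    then have "{w \<in> U. Q (z + w) = c} = (if c = 0 then U else {})"
      by auto
    then show ?thesis by simp
  qed
  have eq_outside: "card F * card {w \<in> U. Q (z + w) = c} = card U" if "z \<notin> U" for z
  proof -
    obtain w where "w \<in> U" "B z w \<noteq> 0"
      using self_perp \<open>z \<notin> U\<close> by blast
    then have "card F * card {w \<in> U. B z w = c - Q z} = card U"
      using card_functional_fibre[OF B_functional U] c Q_F diff_F by blast
    moreover have "{w \<in> U. Q (z + w) = c} = {w \<in> U. B z w = c - Q z}"
      using isotropic by (auto simp: Q_add eq_diff_eq add.commute B_commute)
    ultimately show ?thesis by simp
  qed
  \<comment> \<open>The sum counts the pairs \<open>(z, w)\<close> with \<open>w\<close> in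
    \<open>U\<close> and \<open>Q (z + w) = c\<close>. For fixed \<open>w\<close>, shifting by
    \<open>w\<close> gives the whole level set; for fixed \<open>z\<close>, the coset counts above
    apply.\<close>
  have "(\<Sum>z\<in>UNIV. card {w \<in> U. Q (z + w) = c}) = card {z. Q z = c} * card U"
  proof (rule sum_multicount)
    show "\<forall>w\<in>U. card {z \<in> UNIV. Q (z + w) = c} = card {z. Q z = c}"
    proof
      fix w
      have "bij_betw (\<lambda>z. z + w) {z. Q (z + w) = c} {z. Q z = c}"
        by (rule bij_betw_byWitness[of _ "\<lambda>z. z - w"]) auto
      then show "card {z \<in> UNIV. Q (z + w) = c} = card {z. Q z = c}"
        using bij_betw_same_card by force
    qed
  qed auto
  then have "card F * card {z. Q z = c} * card U
      = (\<Sum>z\<in>UNIV. card F * card {w \<in> U. Q (z + w) = c})"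
    by (simp add: sum_distrib_left[symmetric] mult.assoc)
  also have "\<dots> = (\<Sum>z\<in>U. card F * card {w \<in> U. Q (z + w) = c})
      + (\<Sum>z\<in>-U. card F * card {w \<in> U. Q (z + w) = c})"
    by (subst sum.union_disjoint[symmetric]) (auto intro: sum.cong)
  also have "\<dots> = card U * (if c = 0 then card F * card U else 0) + card (- U) * card U"
    using eq_inside eq_outside by simp
  finally have "card F * card {z. Q z = c} * card U + card U * card U
     = card U * (if c = 0 then card F * card U else 0) + (card (- U) + card U) * card U"
    by (simp add: algebra_simps)
  also have "card (- U) + card U = card (UNIV :: 'v set)"
    using card_Un_disjoint[of "- U" U] by simp
  finally have "(card F * card {z. Q z = c} + card U) * card U
     = (card (UNIV :: 'v set) + (if c = 0 then card F * card U else 0)) * card U"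
    by (simp add: algebra_simps)
  then show ?thesis
    using U_pos unfolding mult_cancel2 by linarith
qed

text \<open>On a line in direction \<open>n\<close> the form is affine with slope
  \<open>B n z\<close>, and \<open>B n\<close> is constant there since
  \<open>B n n = 2 * Q n = 0\<close>. Hence each line off the hyperplane \<open>B n z = 0\<close>
  contains exactly one zero, whatever the total number of zeros of \<open>Q\<close>.\<close>

lemma card_zeros_perp_isotropic:
  assumes n: "Q n = 0" and w: "B n w \<noteq> 0"
  shows "card F ^ 2 * card {z. Q z = 0 \<and> B n z \<noteq> 0} = (card F - 1) * card (UNIV :: 'v set)"
proof -
  have Bn: "B n (z + scale s n) = B n z" if "s \<in> F" for s z
    using that B_same[of n] n by (simp add: B_add B_scale)
  have "card {z. B n z \<noteq> 0} * 1 = card F * card {z. Q z = 0 \<and> B n z \<noteq> 0}"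
  proof (rule card_double_count)
    show "card {s \<in> F. Q (z + scale s n) = 0} = 1" if "z \<in> {z. B n z \<noteq> 0}" for z
    proof -
      have "{s \<in> F. Q (z + scale s n) = 0} = {s \<in> F. Q z + s * B n z = 0}"
        using n by (auto simp: Q_add_scale)
      then show ?thesis
        using card_affine_solution[of "B n z" "Q z"] that Q_F B_F by simp
    qed
    show "card {z \<in> {z. B n z \<noteq> 0}. Q (z + scale s n) = 0} = card {z. Q z = 0 \<and> B n z \<noteq> 0}"
      if s: "s \<in> F" for s
    proof (rule bij_betw_same_card[of "\<lambda>z. z + scale s n"], rule bij_betw_byWitness[of _ "\<lambda>z. z - scale s n"])
      have "B n (z - scale s n) = B n z" for z
        using Bn[OF minus_F[OF s]] scale_minus[of s n] by simp
      then show "(\<lambda>z. z + scale s n) ` {z \<in> {z. B n z \<noteq> 0}. Q (z + scale s n) = 0} \<subseteq> {z. Q z = 0 \<and> B n z \<noteq> 0}"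
        "(\<lambda>z. z - scale s n) ` {z. Q z = 0 \<and> B n z \<noteq> 0} \<subseteq> {z \<in> {z. B n z \<noteq> 0}. Q (z + scale s n) = 0}"
        using Bn s by auto
    qed auto
  qed auto
  then have 1: "card {z. B n z \<noteq> 0} = card F * card {z. Q z = 0 \<and> B n z \<noteq> 0}"
    by simp
  have 2: "card F * card {z. B n z = 0} = card (UNIV :: 'v set)"
    using card_functional_fibre[OF B_functional subspace_UNIV UNIV_I w zero_F] by simp
  have 3: "card {z. B n z \<noteq> 0} + card {z. B n z = 0} = card (UNIV :: 'v set)"
    by (subst card_Un_disjoint[symmetric]) (auto intro: arg_cong[of _ _ card])
  have "card F * card {z. B n z \<noteq> 0} + card (UNIV :: 'v set) = card F * card (UNIV :: 'v set)"
    using 2 3 by (metis distrib_left)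
  then show ?thesis
    unfolding 1 by (simp add: power2_eq_square algebra_simps)
qed

text \<open>In the space \<open>V \<oplus> F\<close> with the form \<open>Q z - Q n * r\<^sup>2\<close> the vector \<open>(n, 1)\<close> is isotropic, so the
  argument of the previous lemma applies to it.  All nonzero levels of \<open>Q\<close> having the same
  cardinality, this form has as many zeros as \<open>V\<close> has elements.\<close>

lemma card_zeros_perp_anisotropic:
  assumes n: "Q n \<noteq> 0"
    and level: "\<And>c. c \<in> F \<Longrightarrow> c \<noteq> 0 \<Longrightarrow> card {z. Q z = c} = N"
  shows "card F ^ 2 * card {z. Q z = 0 \<and> B n z = 0} = card (UNIV :: 'v set)"
proof -
  let ?V = "UNIV :: 'v set"
  define c0 where "c0 = Q n"
  have c0: "c0 \<in> F" "c0 \<noteq> 0"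
    using n Q_F by (auto simp: c0_def)
  have two_F: "2 \<in> F"
    using add_F[OF one_F one_F] by simp
  have r2: "c0 * r ^ 2 \<in> F" if "r \<in> F" for r
    using that c0 mult_F by (simp add: power2_eq_square)
  \<comment> \<open>\<open>f\<close> is the extended form, \<open>g\<close> its polar form against
    \<open>(n, 1)\<close>, and \<open>\<tau> s\<close> the shift by \<open>s\<close> times
    \<open>(n, 1)\<close>. As \<open>f (n, 1) = 0\<close>, shifting changes \<open>f\<close>
    affinely with slope \<open>g\<close> and leaves \<open>g\<close> fixed.\<close>
  define f where "f = (\<lambda>(z, r). Q z - c0 * r ^ 2)"
  define g where "g = (\<lambda>(z, r). B n z - 2 * c0 * r)"
  define P where "P = ?V \<times> F"
  define \<tau> where "\<tau> = (\<lambda>s (z, r). (z + scale s n, r + s))"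
  have f_F: "f w \<in> F" and g_F: "g w \<in> F" if "w \<in> P" for w
    using that c0 two_F r2 Q_F B_F unfolding P_def f_def g_def
    by (auto intro!: diff_F mult_F simp: power2_eq_square)
  have f\<tau>: "f (\<tau> s w) = f w + s * g w" if "s \<in> F" "w \<in> P" for s w
    using that by (auto simp: f_def g_def \<tau>_def P_def Q_add_scale c0_def power2_eq_square algebra_simps)
  have g\<tau>: "g (\<tau> s w) = g w" if "s \<in> F" "w \<in> P" for s w
    using that B_same[of n] by (auto simp: f_def g_def \<tau>_def P_def B_add B_scale c0_def algebra_simps)
  have \<tau>P: "\<tau> s w \<in> P" if "s \<in> F" "w \<in> P" for s w
    using that add_F by (auto simp: \<tau>_def P_def)
  have \<tau>\<tau>: "\<tau> s (\<tau> (- s) w) = w" "\<tau> (- s) (\<tau> s w) = w" for s w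
    by (auto simp: \<tau>_def scale_minus split: prod.splits)
  have finP: "finite P"
    using finite_F by (simp add: P_def)
  have "card {w \<in> P. g w \<noteq> 0} * 1 = card F * card {w \<in> P. g w \<noteq> 0 \<and> f w = 0}"
  proof (rule card_double_count)
    show "card {s \<in> F. f (\<tau> s w) = 0} = 1" if w: "w \<in> {w \<in> P. g w \<noteq> 0}" for w
    proof -
      have "{s \<in> F. f (\<tau> s w) = 0} = {s \<in> F. f w + s * g w = 0}"
        using w by (intro Collect_cong conj_cong refl) (simp add: f\<tau>)
      then show ?thesis
        using card_affine_solution[of "g w" "f w"] w f_F g_F by simp
    qed
    show "card {w \<in> {w \<in> P. g w \<noteq> 0}. f (\<tau> s w) = 0} = card {w \<in> P. g w \<noteq> 0 \<and> f w = 0}"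
      if s: "s \<in> F" for s
    proof (rule bij_betw_same_card[of "\<tau> s"], rule bij_betw_byWitness[of _ "\<tau> (- s)"])
      show "\<tau> s ` {w \<in> {w \<in> P. g w \<noteq> 0}. f (\<tau> s w) = 0} \<subseteq> {w \<in> P. g w \<noteq> 0 \<and> f w = 0}"
        "\<tau> (- s) ` {w \<in> P. g w \<noteq> 0 \<and> f w = 0} \<subseteq> {w \<in> {w \<in> P. g w \<noteq> 0}. f (\<tau> s w) = 0}"
        using s minus_F[OF s] by (auto simp: \<tau>\<tau> \<tau>P g\<tau> simp del: split_paired_All)
    qed (auto simp: \<tau>\<tau>)
  qed (use finP in auto)
  then have off_perp: "card {w \<in> P. g w \<noteq> 0} = card F * card {w \<in> P. g w \<noteq> 0 \<and> f w = 0}"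
    by simp
  have t_F: "B n z / (2 * c0) \<in> F" for z
    using B_F two_F c0 by (intro divide_F mult_F)
  have g0: "g (z, r) = 0 \<longleftrightarrow> r = B n z / (2 * c0)" for z r
    using two_nonzero c0 by (auto simp: g_def field_simps)
  \<comment> \<open>As \<open>2 * c0\<close> is invertible, the hyperplane \<open>g = 0\<close> is a
    graph over the whole space.\<close>
  have "bij_betw (\<lambda>z. (z, B n z / (2 * c0))) ?V {w \<in> P. g w = 0}"
    by (rule bij_betw_byWitness[of _ fst]) (use g0 t_F in \<open>auto simp: P_def\<close>)
  then have perp: "card {w \<in> P. g w = 0} = card ?V"
    using bij_betw_same_card by force
  have "card P = card {w \<in> P. g w \<noteq> 0} + card {w \<in> P. g w = 0}"
    using finP by (subst card_Un_disjoint[symmetric]) (auto intro: arg_cong[of _ _ card])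
  then have c1: "card F * card ?V = card F * card {w \<in> P. g w \<noteq> 0 \<and> f w = 0} + card ?V"
    using off_perp perp by (simp add: P_def card_cartesian_product mult.commute)
  \<comment> \<open>The map taking \<open>r\<close> to \<open>c0 * r ^ 2\<close> is no permutation
    of \<open>F\<close>, but it fixes \<open>0\<close> and sends nonzero elements to nonzero ones,
    whose levels all have size \<open>N\<close>.\<close>
  have "(\<Sum>r\<in>F. card {z. Q z = c0 * r ^ 2}) = (\<Sum>c\<in>F. card {z. Q z = c})"
  proof -
    have "(\<Sum>r\<in>F. card {z. Q z = c0 * r ^ 2}) = card {z. Q z = 0} + (\<Sum>r\<in>F-{0}. N)"
      using finite_F zero_F c0 level r2 by (subst sum.remove[of _ 0]) auto
    also have "\<dots> = (\<Sum>c\<in>F. card {z. Q z = c})"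
      using finite_F zero_F level by (subst sum.remove[of F 0 "\<lambda>c. card {z. Q z = c}"]) auto
    finally show ?thesis .
  qed
  also have "\<dots> = card (\<Union>c\<in>F. {z. Q z = c})"
    using finite_F by (subst card_UN_disjoint) auto
  also have "(\<Union>c\<in>F. {z. Q z = c}) = ?V"
    using Q_F by auto
  finally have "(\<Sum>r\<in>F. card {z. Q z = c0 * r ^ 2}) = card ?V" .
  moreover have "card {w \<in> P. f w = 0} = (\<Sum>r\<in>F. card {z. Q z = c0 * r ^ 2})"
  proof -
    have "bij_betw prod.swap {w \<in> P. f w = 0} (SIGMA r:F. {z. Q z = c0 * r ^ 2})"
      by (rule bij_betw_byWitness[of _ prod.swap]) (auto simp: P_def f_def)
    then show ?thesis
      using finite_F by (simp add: bij_betw_same_card)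
  qed
  moreover have "card {w \<in> P. f w = 0}
      = card {w \<in> P. g w \<noteq> 0 \<and> f w = 0} + card {w \<in> P. g w = 0 \<and> f w = 0}"
    using finP by (subst card_Un_disjoint[symmetric]) (auto intro: arg_cong[of _ _ card])
  ultimately have c2: "card ?V = card {w \<in> P. g w \<noteq> 0 \<and> f w = 0} + card {w \<in> P. g w = 0 \<and> f w = 0}"
    by simp
  have "card F * card ?V = card F * card {w \<in> P. g w \<noteq> 0 \<and> f w = 0}
      + card F * card {w \<in> P. g w = 0 \<and> f w = 0}"
    by (simp only: distrib_left[symmetric] c2[symmetric])
  with c1 have c3: "card F * card {w \<in> P. g w = 0 \<and> f w = 0} = card ?V"
    by simp
  \<comment> \<open>The zeros of \<open>f\<close> on \<open>g = 0\<close> form a union of lines in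
    direction \<open>(n, 1)\<close>, each of which meets the slice \<open>r = 0\<close> once; that
    slice is the set to be counted.\<close>
  have "bij_betw (\<lambda>(z, s). \<tau> s (z, 0)) ({z. Q z = 0 \<and> B n z = 0} \<times> F) {w \<in> P. g w = 0 \<and> f w = 0}"
  proof (rule bij_betw_byWitness[of _ "\<lambda>(z, r). (fst (\<tau> (- r) (z, r)), r)"])
    have "g (z, 0) = B n z" "f (z, 0) = Q z" "(z, 0) \<in> P" for z
      using zero_F by (auto simp: g_def f_def P_def)
    then show "(\<lambda>(z, s). \<tau> s (z, 0)) ` ({z. Q z = 0 \<and> B n z = 0} \<times> F) \<subseteq> {w \<in> P. g w = 0 \<and> f w = 0}"
      by (auto simp: \<tau>P f\<tau> g\<tau>)
    have *: "\<tau> (- r) (z, r) = (fst (\<tau> (- r) (z, r)), 0)" for z r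
      by (simp add: \<tau>_def)
    have "f (fst (\<tau> (- r) (z, r)), 0) = 0 \<and> g (fst (\<tau> (- r) (z, r)), 0) = 0"
      if "(z, r) \<in> P" "g (z, r) = 0" "f (z, r) = 0" for z r
      using that f\<tau>[of "- r" "(z, r)"] g\<tau>[of "- r" "(z, r)"] * minus_F
      by (auto simp: P_def)
    then show "(\<lambda>(z, r). (fst (\<tau> (- r) (z, r)), r)) ` {w \<in> P. g w = 0 \<and> f w = 0}
        \<subseteq> {z. Q z = 0 \<and> B n z = 0} \<times> F"
      by (auto simp: P_def f_def g_def)
  qed (auto simp: \<tau>_def scale_minus)
  then have "card {w \<in> P. g w = 0 \<and> f w = 0} = card {z. Q z = 0 \<and> B n z = 0} * card F"
    by (auto dest!: bij_betw_same_card simp: card_cartesian_product)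
  with c3 show ?thesis
    by (simp add: power2_eq_square algebra_simps)
qed

end

section \<open>Powers, Frobenius maps and the trace in a finite field\<close>

lemma power_double_diff_one: "(x::nat) ^ (2 * n) - 1 = (x ^ n + 1) * (x ^ n - 1)"
  by (cases "x ^ n") (auto simp: mult_2 power_add power_0_left)

lemma dvd_power_diff_one: "b dvd a \<Longrightarrow> (x::nat) ^ b - 1 dvd x ^ a - 1"
proof (elim dvdE)
  fix k assume "a = b * k"
  moreover have "[(x ^ b) ^ k = 1 ^ k] (mod (x ^ b - 1))" if "x > 0"
    by (rule cong_pow) (use that in \<open>simp add: cong_altdef_nat\<close>)
  moreover have "x > 0 \<Longrightarrow> x ^ a \<ge> 1" by simp
  ultimately show ?thesis
    by (cases "x = 0") (auto simp: cong_altdef_nat power_mult power_0_left)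
qed

text \<open>The multiplicative order of \<open>x\<close> modulo \<open>d\<close> divides both
  exponents, hence their gcd.\<close>

lemma dvd_power_diff_one_gcd:
  assumes "(d::nat) dvd x ^ a - 1" "d dvd x ^ b - 1" "x > 0"
  shows "d dvd x ^ gcd a b - 1"
proof -
  have "[x ^ a = 1] (mod d)" "[x ^ b = 1] (mod d)"
    using assms by (auto simp: cong_altdef_nat)
  then have "[x ^ gcd a b = 1] (mod d)"
    by (simp only: ord_divides gcd_greatest_iff)
  then show ?thesis
    using assms by (simp add: cong_altdef_nat)
qed

lemma gcd_power_diff_one:
  "x > 0 \<Longrightarrow> gcd (x ^ a - 1) (x ^ b - 1) = (x::nat) ^ gcd a b - 1"
  by (intro dvd_antisym dvd_power_diff_one_gcd gcd_greatest dvd_power_diff_one) auto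

lemma card_power_eq_one_le:
  assumes "d > 0"
  shows "card {x :: 'a::{finite,field}. x ^ d = 1} \<le> d"
proof -
  have deg: "degree (monom 1 d - 1 :: 'a poly) = d"
    using assms degree_add_eq_left[of "- 1 :: 'a poly" "monom 1 d"] by (simp add: degree_monom_eq)
  then have "monom 1 d - 1 \<noteq> (0 :: 'a poly)"
    using assms by auto
  then have "card {x :: 'a. poly (monom 1 d - 1) x = 0} \<le> d"
    using card_poly_roots_bound deg by metis
  then show ?thesis
    by (simp add: poly_monom)
qed

locale finite_field_of_order =
  fixes p m :: nat and ty :: "'a::{finite,field} itself"
  assumes prime_p: "prime p" and odd_p: "odd p" and m_pos: "m > 0"
    and card_UNIV_eq: "card (UNIV :: 'a set) = p ^ m"
begin

lemma p_gt_2: "p > 2"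
  using prime_p odd_p by (metis dvd_refl le_neq_implies_less prime_ge_2_nat)

lemma CHAR_eq: "CHAR('a) = p"
proof -
  have "prime CHAR('a)"
    using finite_imp_CHAR_pos[where 'a = 'a] prime_CHAR_semidom[where 'a = 'a] by simp
  moreover have "CHAR('a) dvd p ^ m"
    using CHAR_dvd_CARD[where 'a = 'a] card_UNIV_eq by simp
  ultimately show ?thesis
    using prime_p by (metis prime_dvd_power primes_dvd_imp_eq)
qed

lemma order_gt_1: "p ^ m > 1"
  using p_gt_2 m_pos by (intro one_less_power) auto

lemma power_order_minus_one: "x ^ (p ^ m - 1) = 1" if "x \<noteq> (0 :: 'a)"
proof -
  let ?S = "UNIV - {0 :: 'a}"
  have "(\<Prod>y\<in>?S. x * y) = (\<Prod>y\<in>?S. y)"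
    by (rule prod.reindex_bij_witness[of _ "\<lambda>y. y / x" "(*) x"]) (use that in auto)
  moreover have "(\<Prod>y\<in>?S. x * y) = x ^ (p ^ m - 1) * (\<Prod>y\<in>?S. y)"
    by (simp add: prod.distrib card_UNIV_eq)
  ultimately show ?thesis
    by simp
qed

lemma power_order: "(x :: 'a) ^ (p ^ m) = x"
proof (cases "x = 0")
  case False
  have "x ^ (p ^ m) = x * x ^ (p ^ m - 1)"
    using order_gt_1 by (metis One_nat_def Suc_pred less_trans power_Suc zero_less_one)
  then show ?thesis
    using False power_order_minus_one by simp
qed (use prime_p in \<open>simp add: prime_gt_0_nat\<close>)

lemma frob_add: "((x :: 'a) + y) ^ (p ^ n) = x ^ (p ^ n) + y ^ (p ^ n)"
  by (rule freshmans_dream') (auto simp: CHAR_eq prime_p)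

lemma frob_minus: "(- (x :: 'a)) ^ (p ^ n) = - (x ^ (p ^ n))"
  using odd_p by simp

lemma frob_diff: "((x :: 'a) - y) ^ (p ^ n) = x ^ (p ^ n) - y ^ (p ^ n)"
  using frob_add[of x "- y" n] by (simp add: frob_minus)

lemma inj_frob: "inj (\<lambda>x :: 'a. x ^ (p ^ n))"
proof (rule injI)
  fix x y :: 'a assume "x ^ (p ^ n) = y ^ (p ^ n)"
  then have "(x - y) ^ (p ^ n) = 0"
    by (simp add: frob_diff)
  then show "x = y" by simp
qed

lemma surj_frob: "surj (\<lambda>x :: 'a. x ^ (p ^ n))"
  using finite_UNIV_inj_surj[OF _ inj_frob] by simp

text \<open>No generator of the multiplicative group is needed. The kernel of the
  \<open>d\<close>-th power map has at most \<open>d\<close> elements, its image lies among the at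
  most \<open>(p ^ m - 1) div d\<close> roots of unity of the complementary order, and the two sizes
  multiply to \<open>p ^ m - 1\<close>; so every bound is attained.\<close>

lemma power_roots_and_image:
  assumes "d dvd p ^ m - 1"
  shows "card {x :: 'a. x ^ d = 1} = d"
    and "(\<lambda>x. x ^ d) ` (UNIV - {0 :: 'a}) = {x. x ^ ((p ^ m - 1) div d) = 1}"
proof -
  let ?S = "UNIV - {0 :: 'a}" and ?K = "{x :: 'a. x ^ d = 1}" and ?e = "(p ^ m - 1) div d"
  have de: "d * ?e = p ^ m - 1"
    using assms by simp
  have d: "d > 0" and e: "?e > 0"
    using de order_gt_1 by (metis nat_0_less_mult_iff zero_less_diff)+
  have sub: "(\<lambda>x. x ^ d) ` ?S \<subseteq> {x. x ^ ?e = 1}"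
    using power_order_minus_one by (auto simp only: de simp flip: power_mult)
  have fibre: "card {x \<in> ?S. x ^ d = y} = card ?K" if y: "y \<in> (\<lambda>x. x ^ d) ` ?S" for y
  proof -
    obtain a where a: "a \<noteq> 0" "y = a ^ d"
      using y by auto
    have "bij_betw ((*) a) ?K {x \<in> ?S. x ^ d = y}"
      by (rule bij_betw_byWitness[of _ "\<lambda>x. x / a"])
        (use a d in \<open>auto simp: power_mult_distrib power_divide power_0_left\<close>)
    then show ?thesis
      using bij_betw_same_card by force
  qed
  have "card ?S = (\<Sum>y\<in>(\<lambda>x. x ^ d) ` ?S. card {x \<in> ?S. x ^ d = y})"
    using sum.image_gen[of ?S "\<lambda>_. 1::nat" "\<lambda>x. x ^ d"] by simp
  also have "\<dots> = card ((\<lambda>x. x ^ d) ` ?S) * card ?K"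
    using fibre by simp
  finally have total: "d * ?e = card ((\<lambda>x. x ^ d) ` ?S) * card ?K"
    unfolding de by (simp add: card_UNIV_eq)
  have K_le: "card ?K \<le> d" and I_le: "card ((\<lambda>x. x ^ d) ` ?S) \<le> card {x :: 'a. x ^ ?e = 1}"
    and E_le: "card {x :: 'a. x ^ ?e = 1} \<le> ?e"
    using card_power_eq_one_le d e sub by (auto intro: card_mono)
  show "card ?K = d"
  proof (rule ccontr)
    assume "card ?K \<noteq> d"
    then have "card ?K < d" using K_le by simp
    then have "?e * card ?K < ?e * d"
      using e by simp
    moreover have "card ((\<lambda>x. x ^ d) ` ?S) * card ?K \<le> ?e * card ?K"
      using I_le E_le by (intro mult_le_mono1) simp
    ultimately have "card ((\<lambda>x. x ^ d) ` ?S) * card ?K < d * ?e"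
      by (simp only: mult.commute)
    then show False using total by simp
  qed
  then have "card ((\<lambda>x. x ^ d) ` ?S) = ?e"
    using total d by simp
  then show "(\<lambda>x. x ^ d) ` ?S = {x. x ^ ?e = 1}"
    using sub E_le I_le by (intro card_seteq) auto
qed

text \<open>By Bezout modulo \<open>p ^ m - 1\<close>, every power with exponent the gcd is an
  \<open>n\<close>-th power; this reduces arbitrary exponents to divisors of the group
  order.\<close>

lemma power_gcd_bezout:
  assumes "n > 0"
  obtains t where "\<And>x :: 'a. x \<noteq> 0 \<Longrightarrow> (x ^ t) ^ n = x ^ gcd n (p ^ m - 1)"
proof -
  obtain t y where "n * t = (p ^ m - 1) * y + gcd n (p ^ m - 1)"
    using bezout_nat[of n "p ^ m - 1"] assms by blast
  then have "(x ^ t) ^ n = x ^ gcd n (p ^ m - 1)" if "x \<noteq> 0" for x :: 'a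
    using power_order_minus_one[OF that]
    by (metis mult.commute power_add power_mult power_one mult_1)
  then show ?thesis using that by blast
qed

lemma ex_power_eq:
  assumes "n > 0" and "c ^ ((p ^ m - 1) div gcd n (p ^ m - 1)) = (1 :: 'a)"
  obtains x where "x \<noteq> 0" "x ^ n = c"
proof -
  obtain t where t: "\<And>x :: 'a. x \<noteq> 0 \<Longrightarrow> (x ^ t) ^ n = x ^ gcd n (p ^ m - 1)"
    using power_gcd_bezout assms(1) by blast
  have "c \<in> (\<lambda>x. x ^ gcd n (p ^ m - 1)) ` (UNIV - {0})"
    using power_roots_and_image(2)[of "gcd n (p ^ m - 1)"] assms by simp
  then obtain y where "y \<noteq> 0" "c = y ^ gcd n (p ^ m - 1)"
    by auto
  then show ?thesis
    using that[of "y ^ t"] t by simp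
qed

lemma card_power_eq_one:
  assumes "n > 0"
  shows "card {x :: 'a. x ^ n = 1} = gcd n (p ^ m - 1)"
proof -
  obtain t where t: "\<And>x :: 'a. x \<noteq> 0 \<Longrightarrow> (x ^ t) ^ n = x ^ gcd n (p ^ m - 1)"
    using power_gcd_bezout assms by blast
  have "x ^ gcd n (p ^ m - 1) = 1" if "x ^ n = 1" for x :: 'a
  proof -
    have "x \<noteq> 0"
      using that assms by (auto simp: power_0_left)
    then show ?thesis
      using t[of x] that by (metis mult.commute power_mult power_one)
  qed
  moreover have "x ^ n = 1" if "x ^ gcd n (p ^ m - 1) = 1" for x :: 'a
    using that by (metis dvdE gcd_dvd1 power_mult power_one)
  ultimately have "{x :: 'a. x ^ n = 1} = {x. x ^ gcd n (p ^ m - 1) = 1}"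
    by blast
  then show ?thesis
    by (simp add: power_roots_and_image(1))
qed

lemma frob_minus_one: "x \<noteq> (0 :: 'a) \<Longrightarrow> x ^ (p ^ n) = x * x ^ (p ^ n - 1)"
  using prime_gt_0_nat[OF prime_p] by (simp flip: power_Suc)

text \<open>The condition on \<open>c\<close> makes it a \<open>(p ^ n - 1)\<close>-th power,
  \<open>c = k ^ (p ^ n - 1)\<close>. Multiplication by \<open>k\<close> then carries the fixed
  field of the \<open>n\<close>-th Frobenius power onto the eigenspace.\<close>

lemma card_frob_eigenspace:
  assumes "n > 0" and "c ^ ((p ^ m - 1) div (p ^ gcd n m - 1)) = (1 :: 'a)"
  shows "card {x :: 'a. x ^ (p ^ n) = c * x} = p ^ gcd n m"
proof -
  have n: "p ^ n - 1 > 0"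
    using p_gt_2 assms(1) one_less_power[of p n] by simp
  have g: "gcd (p ^ n - 1) (p ^ m - 1) = p ^ gcd n m - 1"
    using gcd_power_diff_one p_gt_2 by simp
  obtain k where k: "k \<noteq> 0" "k ^ (p ^ n - 1) = c"
    using ex_power_eq[OF n, of c] assms(2) unfolding g by blast
  have kc: "k ^ (p ^ n) = c * k"
    using frob_minus_one[OF k(1), of n] k(2) by simp
  have c: "c \<noteq> 0"
    using k by auto
  have "bij_betw ((*) k) {x :: 'a. x ^ (p ^ n) = x} {x. x ^ (p ^ n) = c * x}"
    by (rule bij_betw_byWitness[of _ "\<lambda>x. x / k"])
      (use k c kc in \<open>auto simp: power_mult_distrib power_divide\<close>)
  then have "card {x :: 'a. x ^ (p ^ n) = c * x} = card {x :: 'a. x ^ (p ^ n) = x}"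
    using bij_betw_same_card by metis
  also have "{x :: 'a. x ^ (p ^ n) = x} = insert 0 {x. x ^ (p ^ n - 1) = 1}"
  proof (rule Set.set_eqI)
    fix x :: 'a
    show "x \<in> {x. x ^ (p ^ n) = x} \<longleftrightarrow> x \<in> insert 0 {x. x ^ (p ^ n - 1) = 1}"
      using frob_minus_one[of x n] prime_gt_0_nat[OF prime_p] by (cases "x = 0") auto
  qed
  also have "card \<dots> = Suc (card {x :: 'a. x ^ (p ^ n - 1) = 1})"
    using n by (subst card_insert_disjoint) (auto simp: power_0_left)
  also have "\<dots> = p ^ gcd n m"
    using card_power_eq_one[OF n] g prime_gt_0_nat[OF prime_p] by simp
  finally show ?thesis .
qed

definition Fp :: "'a set" where "Fp = {x. x ^ p = x}"

lemma card_Fp: "card Fp = p"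
  using card_frob_eigenspace[of 1 1] by (simp add: Fp_def)

lemma frob_Fp: "x \<in> Fp \<Longrightarrow> x ^ (p ^ n) = x"
  by (induction n) (auto simp: Fp_def power_mult)

lemma Fp_closed:
  "0 \<in> Fp" "1 \<in> Fp" "s \<in> Fp \<Longrightarrow> t \<in> Fp \<Longrightarrow> s + t \<in> Fp" "s \<in> Fp \<Longrightarrow> t \<in> Fp \<Longrightarrow> s - t \<in> Fp"
  "s \<in> Fp \<Longrightarrow> t \<in> Fp \<Longrightarrow> s * t \<in> Fp" "s \<in> Fp \<Longrightarrow> t \<in> Fp \<Longrightarrow> s / t \<in> Fp"
  using frob_add[of s t 1] frob_diff[of s t 1] prime_gt_0_nat[OF prime_p]
  by (auto simp: Fp_def power_mult_distrib power_divide)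

lemma two_nonzero: "(2 :: 'a) \<noteq> 0"
proof
  assume "(2 :: 'a) = 0"
  then have "CHAR('a) dvd 2"
    by (simp flip: of_nat_eq_0_iff_char_dvd)
  then show False
    using p_gt_2 CHAR_eq by (auto dest: dvd_imp_le)
qed

section \<open>The trace and its nondegeneracy\<close>

abbreviation Tr :: "'a \<Rightarrow> 'a" where "Tr \<equiv> trace p m"

lemma Tr_add: "Tr (x + y) = Tr x + Tr y"
  by (simp add: trace_def frob_add sum.distrib)

lemma Tr_0 [simp]: "Tr 0 = 0"
  using prime_gt_0_nat[OF prime_p] by (simp add: trace_def power_0_left)

lemma Tr_minus: "Tr (- x) = - Tr x"
  using Tr_add[of x "- x"] by (simp add: eq_neg_iff_add_eq_0 add.commute)

lemma Tr_diff: "Tr (x - y) = Tr x - Tr y"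
  using Tr_add[of x "- y"] by (simp add: Tr_minus)

lemma Tr_mult_Fp: "c \<in> Fp \<Longrightarrow> Tr (c * x) = c * Tr x"
  by (simp add: trace_def power_mult_distrib frob_Fp sum_distrib_left)

lemma Tr_power_p: "Tr (x ^ p) = Tr x"
proof -
  have "Tr (x ^ p) = (\<Sum>i<m. x ^ (p ^ Suc i))"
    by (simp add: trace_def flip: power_mult)
  \<comment> \<open>Adding \<open>x\<close> turns both traces into the same sum of
    \<open>m + 1\<close> conjugates, the last of which is \<open>x\<close> again.\<close>
  also have "\<dots> + x = (\<Sum>i<Suc m. x ^ (p ^ i))"
    by (subst sum.lessThan_Suc_shift) simp
  also have "\<dots> = Tr x + x"
    by (simp add: trace_def power_order)
  finally show ?thesis by simp
qed

lemma Tr_frob: "Tr (x ^ (p ^ n)) = Tr x"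
  by (induction n) (auto simp: power_mult Tr_power_p mult.commute[of p])

lemma Tr_Fp: "Tr x \<in> Fp"
proof -
  have "Tr x ^ p = Tr (x ^ p)"
    unfolding trace_def
    by (subst freshmans_dream_sum) (auto simp: CHAR_eq prime_p simp flip: power_mult intro: sum.cong simp: mult.commute)
  then show ?thesis
    by (simp add: Fp_def Tr_power_p)
qed

text \<open>The trace is a nonzero polynomial of degree at most \<open>p ^ (m - 1)\<close>, too
  small to vanish on all \<open>p ^ m\<close> elements.\<close>

lemma ex_Tr_nonzero: "\<exists>x. Tr x \<noteq> 0"
proof -
  define P :: "'a poly" where "P = (\<Sum>i<m. monom 1 (p ^ i))"
  have "coeff P (p ^ (m - 1)) = (\<Sum>i<m. if i = m - 1 then 1 else 0)"
    unfolding P_def coeff_sum using p_gt_2 by (intro sum.cong) auto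
  also have "\<dots> = 1"
    using m_pos by simp
  finally have "P \<noteq> 0"
    by auto
  have "degree P \<le> p ^ (m - 1)"
    unfolding P_def
  proof (rule degree_sum_le)
    fix i assume "i \<in> {..<m}"
    then show "degree (monom (1::'a) (p ^ i)) \<le> p ^ (m - 1)"
      using p_gt_2 by (auto simp: degree_monom_eq intro!: power_increasing)
  qed auto
  moreover have "p ^ (m - 1) < p ^ m"
    using p_gt_2 m_pos by simp
  ultimately have "card {x. poly P x = 0} < card (UNIV :: 'a set)"
    using card_poly_roots_bound[OF \<open>P \<noteq> 0\<close>] card_UNIV_eq by simp
  then have "{x. poly P x = 0} \<noteq> UNIV"
    by auto
  moreover have "poly P x = Tr x" for x
    by (simp add: P_def trace_def poly_sum poly_monom)
  ultimately show ?thesis by auto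
qed

lemma Tr_nondegenerate:
  assumes "\<And>x. Tr (a * x) = 0"
  shows "a = 0"
proof (rule ccontr)
  assume "a \<noteq> 0"
  obtain x where "Tr x \<noteq> 0" using ex_Tr_nonzero by blast
  moreover have "Tr x = Tr (a * (x / a))"
    using \<open>a \<noteq> 0\<close> by simp
  ultimately show False using assms by metis
qed

sublocale line: subfield_space Fp "(*)"
  by standard (use Fp_closed in \<open>auto simp: algebra_simps\<close>)

lemma functional_Tr: "line.functional (\<lambda>x. Tr (a * x))"
  using Tr_Fp Tr_mult_Fp[of _ "a * _"]
  by (auto simp: line.functional_def distrib_left Tr_add mult.left_commute)

text \<open>Count the pairs in \<open>UNIV \<times> W\<close> that are orthogonal for the trace form.\<close>

lemma card_perp:
  assumes W: "line.subspace W"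
  shows "card W * card {b. \<forall>w\<in>W. Tr (b * w) = 0} = p ^ m"
proof -
  let ?P = "{b. \<forall>w\<in>W. Tr (b * w) = 0}"
  have W0: "0 \<in> W"
    using W by (simp add: line.subspace_def)
  have "(\<Sum>b\<in>UNIV. card {w \<in> W. Tr (b * w) = 0}) = (\<Sum>w\<in>W. card {b. Tr (b * w) = 0})"
    using sum_multicount_gen[of UNIV W "\<lambda>b w. Tr (b * w) = 0" "\<lambda>w. card {b. Tr (b * w) = 0}"]
    by simp
  then have "(\<Sum>b\<in>UNIV. p * card {w \<in> W. Tr (b * w) = 0}) = (\<Sum>w\<in>W. p * card {b. Tr (b * w) = 0})"
    by (simp flip: sum_distrib_left)
  moreover have "(\<Sum>w\<in>W. p * card {b. Tr (b * w) = 0}) = p * p ^ m + (card W - 1) * p ^ m"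
  proof -
    have "p * card {b. Tr (b * w) = 0} = p ^ m" if w: "w \<noteq> 0" for w
    proof -
      obtain b where "Tr (w * b) \<noteq> 0"
        using Tr_nondegenerate[of w] w by blast
      then show ?thesis
        using line.card_functional_fibre[OF functional_Tr[of w] line.subspace_UNIV, of b 0]
        by (simp add: Fp_closed card_Fp card_UNIV_eq mult.commute)
    qed
    then show ?thesis
      using W0 by (subst sum.remove[of _ 0]) (auto simp: card_UNIV_eq)
  qed
  moreover have "(\<Sum>b\<in>UNIV. p * card {w \<in> W. Tr (b * w) = 0})
      = card ?P * (p * card W) + card (- ?P) * card W"
  proof -
    have "p * card {w \<in> W. Tr (b * w) = 0} = card W" if "b \<in> - ?P" for b
      using that line.card_functional_fibre[OF functional_Tr[of b] W, of _ 0]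
      by (auto simp: Fp_closed card_Fp)
    moreover have "card {w \<in> W. Tr (b * w) = 0} = card W" if "b \<in> ?P" for b
      using that by (auto intro: arg_cong[of _ _ card])
    moreover have "(\<Sum>b\<in>UNIV. p * card {w \<in> W. Tr (b * w) = 0})
        = (\<Sum>b\<in>?P. p * card {w \<in> W. Tr (b * w) = 0}) + (\<Sum>b\<in>- ?P. p * card {w \<in> W. Tr (b * w) = 0})"
      by (subst sum.union_disjoint[symmetric]) (auto intro: sum.cong)
    ultimately show ?thesis by simp
  qed
  ultimately have "card ?P * (p * card W) + card (- ?P) * card W = p * p ^ m + (card W - 1) * p ^ m"
    by simp
  then have "int (card ?P * (p * card W) + card (- ?P) * card W) = int (p * p ^ m + (card W - 1) * p ^ m)"
    by (simp only:)
  moreover have "int (card (- ?P)) = int (p ^ m) - int (card ?P)"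
    using card_Un_disjoint[of ?P "- ?P"] card_UNIV_eq by simp
  moreover have "int (card W - 1) = int (card W) - 1"
    using W0 by (subst of_nat_diff) (auto simp: Suc_le_eq card_gt_0_iff)
  ultimately have "int p * int (p ^ m) + (int (card W) - 1) * int (p ^ m)
     = int (card ?P) * (int p * int (card W)) + (int (p ^ m) - int (card ?P)) * int (card W)"
    by (simp only: of_nat_add of_nat_mult)
  then have "(int p - 1) * int (card W * card ?P) = (int p - 1) * int (p ^ m)"
    by (simp add: algebra_simps)
  then show ?thesis
    using p_gt_2 by (simp add: mult_cancel_left flip: of_nat_mult of_nat_power)
qed

end

section \<open>The quadratic form of the code\<close>

locale trace_code = finite_field_of_order p m ty
  for p m :: nat and ty :: "'a::{finite,field} itself" +
  fixes u :: nat
  assumes u_pos: "u > 0" and quotient_mod_4: "(m div gcd m u) mod 4 = 0"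
begin

section \<open>Divisibility consequences of the condition on \<open>m / v\<close>\<close>

definition v :: nat where "v = gcd m u"

lemma v_pos: "v > 0"
  using u_pos by (simp add: v_def)

lemma four_v_dvd: "4 * v dvd m"
proof -
  have "4 dvd m div v" "v dvd m"
    using quotient_mod_4 by (auto simp: v_def)
  then show ?thesis
    using v_pos by (simp add: dvd_div_iff_mult)
qed

lemma two_v_dvd: "2 * v dvd m"
  using four_v_dvd dvd_trans[of "2 * v" "4 * v" m] by simp

lemma v_le: "4 * v \<le> m"
  using four_v_dvd m_pos by (rule dvd_imp_le)

text \<open>If \<open>u / v\<close> were even, then \<open>2 * v\<close>, which divides
  \<open>m\<close>, would divide \<open>gcd m u = v\<close>.\<close>

lemma u_eq: obtains t where "v * (2 * t + 1) = u"
proof -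
  obtain l where l: "v * l = u"
    by (metis dvdE gcd_dvd2 v_def)
  have "odd l"
  proof
    assume "even l"
    then have "2 * v dvd v * l"
      by (metis dvd_refl mult.commute mult_dvd_mono)
    then have "2 * v dvd gcd m u"
      using two_v_dvd by (simp add: l)
    then have "2 * v dvd v"
      by (simp add: v_def)
    then show False
      using v_pos by (auto dest: dvd_imp_le)
  qed
  then obtain t where "l = 2 * t + 1"
    by (rule oddE)
  then show ?thesis
    using that l by blast
qed

lemma gcd_u_m: "gcd u m = v"
  by (simp add: v_def gcd.commute)

lemma gcd_2u_m: "gcd (2 * u) m = 2 * v"
proof (rule dvd_antisym)
  show "gcd (2 * u) m dvd 2 * v"
  proof -
    have "gcd (2 * u) m dvd gcd (2 * u) (2 * m)"
      by (meson dvd_triv_right gcd_mono dvd_refl)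
    then show ?thesis
      by (simp add: gcd_mult_distrib_nat[symmetric] gcd_u_m)
  qed
  show "2 * v dvd gcd (2 * u) m"
  proof (rule gcd_greatest)
    show "2 * v dvd 2 * u" by (simp add: v_def)
    show "2 * v dvd m" by (rule two_v_dvd)
  qed
qed

lemma p_power_4v: "p ^ (4 * v) - 1 = (p ^ v - 1) * (p ^ v + 1) * (p ^ (2 * v) + 1)"
proof -
  obtain r where r: "p ^ v = Suc r"
    using prime_gt_0_nat[OF prime_p] by (metis gr0_implies_Suc zero_less_power)
  have "p ^ (4 * v) = (p ^ v) ^ 4" "p ^ (2 * v) = (p ^ v) ^ 2"
    by (simp_all add: mult.commute flip: power_mult)
  then show ?thesis
    by (simp add: r eval_nat_numeral algebra_simps)
qed

text \<open>\<open>p ^ (4 * v) - 1\<close> divides \<open>p ^ m - 1\<close>, and its factors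
  \<open>p ^ v + 1\<close> and \<open>p ^ (2 * v) + 1\<close> are even. The first statement serves
  an eigenvalue of \<open>sig\<close> whose fourth power is \<open>1\<close>, the second the
  eigenvalue \<open>-1\<close> that defines the radical, the third the existence of
  \<open>\<alpha>\<close>.\<close>

lemma dvd_order_minus_one:
  "4 * (p ^ v - 1) dvd p ^ m - 1" "2 * (p ^ (2 * v) - 1) dvd p ^ m - 1"
  "2 * (p ^ v + 1) * (p - 1) dvd p ^ m - 1"
proof -
  have big: "p ^ (4 * v) - 1 dvd p ^ m - 1"
    using dvd_power_diff_one four_v_dvd by blast
  have even: "2 dvd p ^ v + 1" "2 dvd p ^ (2 * v) + 1"
    using odd_p by auto
  have "p ^ 1 - 1 dvd p ^ v - 1"
    by (rule dvd_power_diff_one) simp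
  then have pv: "p - 1 dvd p ^ v - 1" by simp
  have "(p ^ v - 1) * 2 * 2 dvd p ^ (4 * v) - 1"
    unfolding p_power_4v by (intro mult_dvd_mono even dvd_refl)
  from dvd_trans[OF this big] show "4 * (p ^ v - 1) dvd p ^ m - 1"
    by (simp add: mult.commute)
  have "p ^ (2 * v) - 1 = (p ^ v - 1) * (p ^ v + 1)"
    by (simp only: power_double_diff_one mult.commute)
  then have "(p ^ (2 * v) - 1) * 2 dvd p ^ (4 * v) - 1"
    unfolding p_power_4v using even(2) by (metis dvd_refl mult_dvd_mono)
  from dvd_trans[OF this big] show "2 * (p ^ (2 * v) - 1) dvd p ^ m - 1"
    by (simp add: mult.commute)
  have "(p - 1) * (p ^ v + 1) * 2 dvd p ^ (4 * v) - 1"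
    unfolding p_power_4v by (intro mult_dvd_mono even dvd_refl pv)
  from dvd_trans[OF this big] show "2 * (p ^ v + 1) * (p - 1) dvd p ^ m - 1"
    by (simp only: mult_ac)
qed

text \<open>The gcd divides both \<open>p ^ (2 * u) - 1\<close> and \<open>p ^ m - 1\<close>, hence
  \<open>p ^ (2 * v) - 1\<close>. As \<open>u\<close> is an odd multiple of \<open>v\<close>, this
  gives \<open>p ^ u = p ^ v\<close> modulo the gcd.\<close>

lemma gcd_power_u_plus_one: "gcd (p ^ u + 1) (p ^ m - 1) dvd p ^ v + 1"
proof -
  define g where "g = gcd (p ^ u + 1) (p ^ m - 1)"
  have "p ^ (2 * u) - 1 = (p ^ u + 1) * (p ^ u - 1)"
    by (rule power_double_diff_one)
  then have "g dvd p ^ (2 * u) - 1"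
    by (simp only: g_def dvd_mult2 gcd_dvd1)
  moreover have "g dvd p ^ m - 1"
    by (simp add: g_def)
  ultimately have "g dvd p ^ (2 * v) - 1"
    using dvd_power_diff_one_gcd[of g p "2 * u" m] gcd_2u_m prime_gt_0_nat[OF prime_p] by simp
  then have one: "[p ^ (2 * v) = 1] (mod g)"
    using prime_gt_0_nat[OF prime_p] by (simp add: cong_altdef_nat)
  obtain t where t: "v * (2 * t + 1) = u" by (rule u_eq)
  have "[(p ^ (2 * v)) ^ t * p ^ v + 1 = 1 ^ t * p ^ v + 1] (mod g)"
    by (intro cong_add cong_mult cong_pow one cong_refl)
  moreover have "(p ^ (2 * v)) ^ t * p ^ v = p ^ u"
    by (subst (3) t[symmetric]) (simp add: algebra_simps flip: power_mult power_add)
  ultimately have "[p ^ u + 1 = p ^ v + 1] (mod g)"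
    by simp
  moreover have "g dvd p ^ u + 1"
    by (simp add: g_def)
  ultimately show ?thesis
    using cong_dvd_iff g_def by blast
qed

definition sig :: "'a \<Rightarrow> 'a" where "sig x = x ^ (p ^ u)"

lemma sig_add: "sig (x + y) = sig x + sig y"
  and sig_mult: "sig (x * y) = sig x * sig y"
  and sig_Fp: "c \<in> Fp \<Longrightarrow> sig c = c"
  and sig_0 [simp]: "sig 0 = 0"
  and Tr_sig: "Tr (sig x) = Tr x"
  and sig_eq_iff: "sig x = sig y \<longleftrightarrow> x = y"
  using prime_gt_0_nat[OF prime_p] inj_eq[OF inj_frob[of u], of x y]
  by (simp_all add: sig_def frob_add power_mult_distrib frob_Fp Tr_frob)

lemma surj_sig: "surj sig"
  unfolding sig_def[abs_def] by (rule surj_frob)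

text \<open>The equation reads \<open>\<alpha> ^ (2 * (p ^ u + 1)) = -1/4\<close>. The right side is
  a nonzero element of the prime field, so its \<open>(p - 1)\<close>-th power is \<open>1\<close>,
  and the criterion for being a power only needs \<open>p - 1\<close> to divide
  \<open>p ^ m - 1\<close> over the gcd.\<close>

lemma ex_isotropy_constant: "\<exists>\<alpha>. \<alpha> \<noteq> 0 \<and> (2 * \<alpha> * sig \<alpha>) ^ 2 = - 1"
proof -
  define n where "n = 2 * (p ^ u + 1)"
  have n: "n > 0" by (simp add: n_def)
  have four: "(2 :: 'a) * 2 \<in> Fp"
    using Fp_closed(3)[OF Fp_closed(2) Fp_closed(2)] by (intro Fp_closed(5)) simp_all
  define c :: 'a where "c = - 1 / (2 * 2)"
  have "c \<in> Fp"
    unfolding c_def using four Fp_closed(4)[OF Fp_closed(1,2)] by (intro Fp_closed(6)) simp_all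
  moreover have "c \<noteq> 0"
    using two_nonzero by (simp add: c_def del: numeral_times_numeral)
  ultimately have c: "c \<in> Fp" "c \<noteq> 0" .
  have "c * c ^ (p - 1) = c * 1"
    using c(1) prime_gt_0_nat[OF prime_p] by (simp add: Fp_def flip: power_Suc)
  then have c1: "c ^ (p - 1) = 1"
    using c(2) by simp
  have "gcd n (p ^ m - 1) dvd gcd n (2 * (p ^ m - 1))"
    by (meson dvd_triv_right gcd_mono dvd_refl)
  also have "\<dots> = 2 * gcd (p ^ u + 1) (p ^ m - 1)"
    unfolding n_def by (simp only: gcd_mult_distrib_nat)
  also have "\<dots> dvd 2 * (p ^ v + 1)"
    using gcd_power_u_plus_one by (intro mult_dvd_mono dvd_refl)
  finally have "gcd n (p ^ m - 1) * (p - 1) dvd 2 * (p ^ v + 1) * (p - 1)"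
    by (intro mult_dvd_mono dvd_refl)
  then have "gcd n (p ^ m - 1) * (p - 1) dvd p ^ m - 1"
    using dvd_order_minus_one(3) dvd_trans by blast
  then obtain l where l: "p ^ m - 1 = gcd n (p ^ m - 1) * (p - 1) * l" by blast
  have "(p ^ m - 1) div gcd n (p ^ m - 1) = (p - 1) * l"
    using n by (subst l) simp
  then have "c ^ ((p ^ m - 1) div gcd n (p ^ m - 1)) = 1"
    using c1 by (simp add: power_mult)
  then obtain \<alpha> where \<alpha>: "\<alpha> \<noteq> 0" "\<alpha> ^ n = c"
    using ex_power_eq[OF n] by blast
  have "\<alpha> ^ n = (\<alpha> * sig \<alpha>) ^ 2"
    by (simp add: n_def sig_def algebra_simps flip: power_mult power_add power_Suc)
  then have "(2 * \<alpha> * sig \<alpha>) ^ 2 = 2 * 2 * c"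
    using \<alpha> by (simp add: power2_eq_square algebra_simps)
  also have "\<dots> = - 1"
    using two_nonzero by (simp add: c_def del: numeral_times_numeral)
  finally show ?thesis using \<alpha> by blast
qed

section \<open>The quadratic form, its radical and an isotropic subspace\<close>

definition scale :: "'a \<Rightarrow> 'a \<times> 'a \<Rightarrow> 'a \<times> 'a" where
  "scale s z = (s * fst z, s * snd z)"

definition Q :: "'a \<times> 'a \<Rightarrow> 'a" where
  "Q z = Tr (fst z ^ 2 + snd z * sig (snd z))"

definition B :: "'a \<times> 'a \<Rightarrow> 'a \<times> 'a \<Rightarrow> 'a" where
  "B w z = Tr (2 * fst w * fst z + snd w * sig (snd z) + snd z * sig (snd w))"

sublocale plane: subfield_space Fp scale
  by standard (use Fp_closed in \<open>auto simp: scale_def algebra_simps\<close>)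

sublocale plane: quadratic_space Fp scale Q B
proof
  show "(2 :: 'a) \<noteq> 0" by (rule two_nonzero)
  show "Q z \<in> Fp" for z by (simp add: Q_def Tr_Fp)
  show "Q (y + z) = Q y + Q z + B y z" for y z
    by (simp add: Q_def B_def sig_add power2_eq_square algebra_simps flip: Tr_add)
  show "Q (scale s z) = s ^ 2 * Q z" if s: "s \<in> Fp" for s z
  proof -
    have "s ^ 2 \<in> Fp"
      using s Fp_closed by (simp add: power2_eq_square)
    moreover have "fst (scale s z) ^ 2 + snd (scale s z) * sig (snd (scale s z))
        = s ^ 2 * (fst z ^ 2 + snd z * sig (snd z))"
      using s by (simp add: scale_def sig_mult sig_Fp power2_eq_square algebra_simps)
    ultimately show ?thesis
      by (simp add: Q_def Tr_mult_Fp)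
  qed
  have "B y (scale s z) = s * B y z" if s: "s \<in> Fp" for s y z
  proof -
    have "2 * fst y * fst (scale s z) + snd y * sig (snd (scale s z)) + snd (scale s z) * sig (snd y)
        = s * (2 * fst y * fst z + snd y * sig (snd z) + snd z * sig (snd y))"
      using s by (simp add: scale_def sig_mult sig_Fp algebra_simps)
    then show ?thesis
      using s by (simp add: B_def Tr_mult_Fp)
  qed
  then show "plane.functional (B y)" for y
    by (auto simp: plane.functional_def B_def Tr_Fp sig_add algebra_simps simp flip: Tr_add)
  have "B z z = Q z + Q z" for z
    unfolding B_def Q_def by (simp add: power2_eq_square algebra_simps flip: Tr_add)
  then show "B z z = 2 * Q z" for z
    by simp
qed

definition radical :: "'a set" where "radical = {y. sig (sig y) = - y}"

text \<open>The radical is the eigenspace of the Frobenius power with exponent \<open>2 * u\<close>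
  for \<open>-1\<close>, and \<open>-1\<close> passes the criterion because \<open>p ^ m - 1\<close>
  is an even multiple of \<open>p ^ (2 * v) - 1\<close>.\<close>

lemma card_radical: "card radical = p ^ (2 * v)"
proof -
  have "radical = {x :: 'a. x ^ (p ^ (2 * u)) = (- 1) * x}"
    by (simp add: radical_def sig_def power_add mult_2 flip: power_mult)
  moreover have "(- 1 :: 'a) ^ ((p ^ m - 1) div (p ^ gcd (2 * u) m - 1)) = 1"
  proof -
    obtain l where "p ^ m - 1 = (p ^ (2 * v) - 1) * (2 * l)"
      using dvd_order_minus_one(2) by (metis dvdE mult.assoc mult.commute)
    moreover have "p ^ (2 * v) - 1 > 0"
      using one_less_power[of p "2 * v"] p_gt_2 v_pos by simp
    ultimately have "(p ^ m - 1) div (p ^ gcd (2 * u) m - 1) = 2 * l"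
      by (simp only: gcd_2u_m) simp
    then show ?thesis by (simp only: power_mult) simp
  qed
  ultimately show ?thesis
    using card_frob_eigenspace[of "2 * u" "- 1"] u_pos gcd_2u_m by simp
qed

lemma radical_subspace: "line.subspace radical"
  unfolding line.subspace_def radical_def
  by (intro conjI ballI CollectI; simp only: mem_Collect_eq sig_add sig_mult sig_Fp sig_0) simp_all

text \<open>On the graph of \<open>f y = \<alpha> y - \<sigma> y / (2 \<alpha>)\<close> the form vanishes because \<open>(2 \<alpha> \<sigma> \<alpha>)\<^sup>2 = -1\<close>.
  \<open>U\<close> is this graph enlarged by the kernel of the adjoint of \<open>f\<close> for the trace form.\<close>

lemma ex_isotropic_subspace:
  "\<exists>U. plane.subspace U \<and> (\<forall>w\<in>U. Q w = 0) \<and>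
     (\<forall>z. (\<forall>w\<in>U. B z w = 0) \<longrightarrow> z \<in> U) \<and> card U = p ^ (m + v)"
proof -
  obtain \<alpha> where \<alpha>: "\<alpha> \<noteq> 0" "(2 * \<alpha> * sig \<alpha>) ^ 2 = - 1"
    using ex_isotropy_constant by blast
  \<comment> \<open>In \<open>f y ^ 2\<close> the mixed term is
    \<open>2 * \<alpha> * \<beta> * y * sig y\<close>; this \<open>\<beta>\<close> makes it cancel
    \<open>y * sig y\<close>. The two squares left must then be negatives up to \<open>sig\<close>,
    that is \<open>\<beta> * \<beta> = - (sig \<alpha> * sig \<alpha>)\<close>, which is the
    condition on \<open>\<alpha>\<close>.\<close>
  define \<beta> where "\<beta> = - 1 / (2 * \<alpha>)"
  define j where "j = 2 * \<alpha> * sig \<alpha>"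
  have j2: "j * j = - 1"
    using \<alpha> by (simp add: j_def power2_eq_square)
  have j0: "j \<noteq> 0"
    using j2 by auto
  have \<alpha>\<beta>: "2 * \<alpha> * \<beta> = - 1"
    using \<alpha> two_nonzero by (simp add: \<beta>_def)
  have j\<beta>: "j * \<beta> = - sig \<alpha>"
  proof -
    have "j * \<beta> = (2 * \<alpha> * \<beta>) * sig \<alpha>"
      by (simp add: j_def)
    then show ?thesis by (simp add: \<alpha>\<beta>)
  qed
  have \<beta>2: "\<beta> * \<beta> = - (sig \<alpha> * sig \<alpha>)"
  proof -
    have "(j * j) * (\<beta> * \<beta>) = sig \<alpha> * sig \<alpha>"
      using j\<beta> by (metis minus_mult_minus mult.assoc mult.left_commute)
    then show ?thesis by (metis j2 minus_minus mult_minus1)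
  qed
  define f where "f y = \<alpha> * y + \<beta> * sig y" for y
  \<comment> \<open>\<open>K\<close> is the kernel of the adjoint of \<open>f\<close> (see
    \<open>adjoint_K\<close>), so adding it in the first coordinate preserves orthogonality to the
    graph. It is the eigenspace of \<open>sig\<close> for \<open>- j\<close>, where
    \<open>j ^ 4 = 1\<close>.\<close>
  define K where "K = {k. j * sig k = k}"
  have K_iff: "k \<in> K \<longleftrightarrow> sig k = - j * k" for k
  proof -
    have "j * sig k = k \<longleftrightarrow> j * (j * sig k) = j * k"
      using j0 by simp
    also have "j * (j * sig k) = - sig k"
      by (simp add: j2 flip: mult.assoc)
    finally have "k \<in> K \<longleftrightarrow> - sig k = j * k"
      by (simp only: K_def mem_Collect_eq)
    also have "\<dots> \<longleftrightarrow> sig k = - j * k"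
      by (metis minus_minus mult_minus_left)
    finally show ?thesis .
  qed
  have card_K: "card K = p ^ v"
  proof -
    have "K = {x. x ^ (p ^ u) = (- j) * x}"
      using K_iff by (auto simp: sig_def)
    moreover have "(- j) ^ ((p ^ m - 1) div (p ^ gcd u m - 1)) = 1"
    proof -
      obtain l where "p ^ m - 1 = (p ^ v - 1) * (4 * l)"
        using dvd_order_minus_one(1) by (metis dvdE mult.assoc mult.commute)
      moreover have "p ^ v - 1 > 0"
        using one_less_power[of p v] p_gt_2 v_pos by simp
      ultimately have "(p ^ m - 1) div (p ^ gcd u m - 1) = 4 * l"
        by (simp only: gcd_u_m) simp
      moreover have "(- j) ^ 4 = (j * j) * (j * j)"
        by (simp add: eval_nat_numeral)
      ultimately show ?thesis by (simp only: power_mult j2) simp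
    qed
    ultimately show ?thesis
      using card_frob_eigenspace[of u "- j"] u_pos gcd_u_m by simp
  qed
  define U where "U = (\<lambda>(y, k). (f y + k, y)) ` (UNIV \<times> K)"
  have U_iff: "z \<in> U \<longleftrightarrow> fst z - f (snd z) \<in> K" for z
  proof
    assume "fst z - f (snd z) \<in> K"
    then show "z \<in> U"
      unfolding U_def by (intro image_eqI[of _ _ "(snd z, fst z - f (snd z))"]) auto
  qed (auto simp: U_def)
  have f_adjoint: "Tr (k * f y) = Tr ((sig k * sig \<alpha> + k * \<beta>) * sig y)" for k y
  proof -
    have "Tr (k * f y) = Tr (k * \<alpha> * y) + Tr (k * \<beta> * sig y)"
      by (simp add: f_def algebra_simps flip: Tr_add)
    also have "Tr (k * \<alpha> * y) = Tr (sig k * sig \<alpha> * sig y)"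
      using Tr_sig[of "k * \<alpha> * y"] by (simp add: sig_mult)
    finally show ?thesis
      by (simp add: algebra_simps flip: Tr_add)
  qed
  have adjoint_K: "sig k * sig \<alpha> + k * \<beta> = 0 \<longleftrightarrow> k \<in> K" for k
  proof -
    have "sig k * sig \<alpha> + k * \<beta> = 0 \<longleftrightarrow> 2 * \<alpha> * (sig k * sig \<alpha> + k * \<beta>) = 0"
      using two_nonzero \<alpha> by simp
    also have "2 * \<alpha> * (sig k * sig \<alpha> + k * \<beta>) = j * sig k + (2 * \<alpha> * \<beta>) * k"
      by (simp add: j_def algebra_simps)
    finally show ?thesis
      by (simp add: \<alpha>\<beta> K_def)
  qed
  have Tr_Kf: "Tr (k * f y) = 0" if "k \<in> K" for k y
  proof -
    have "sig k * sig \<alpha> + k * \<beta> = 0"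
      using adjoint_K that by blast
    then show ?thesis
      by (simp only: f_adjoint) simp
  qed
  have graph: "Tr (f y * f y + y * sig y) = 0" for y
  proof -
    have "f y * f y + y * sig y
        = \<alpha> * \<alpha> * y * y + (\<beta> * \<beta>) * sig y * sig y + (2 * \<alpha> * \<beta> + 1) * (y * sig y)"
      by (simp add: f_def algebra_simps)
    also have "\<dots> = \<alpha> * \<alpha> * y * y - sig (\<alpha> * \<alpha> * y * y)"
      by (simp add: \<alpha>\<beta> \<beta>2 sig_mult)
    finally show ?thesis
      by (simp add: Tr_diff Tr_sig)
  qed
  have Tr_KK: "Tr (k * k) = 0" if "k \<in> K" for k
  proof -
    \<comment> \<open>As \<open>j * j = - 1\<close>, \<open>sig\<close> negates
      \<open>k * k\<close>, while the trace is invariant under \<open>sig\<close>.\<close>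
    have "sig (k * k) = (j * j) * (k * k)"
      using that K_iff by (simp add: sig_mult algebra_simps)
    then have "Tr (k * k) = - Tr (k * k)"
      using Tr_sig[of "k * k"] j2 by (simp add: Tr_minus)
    then have "2 * Tr (k * k) = 0"
      by (simp add: eq_neg_iff_add_eq_0)
    then show ?thesis using two_nonzero by simp
  qed
  have isotropic: "Q w = 0" if w: "w \<in> U" for w
  proof -
    obtain y k where yk: "w = (f y + k, y)" "k \<in> K"
      using w by (auto simp: U_def)
    have "Q w = Tr (f y * f y + y * sig y) + Tr (k * f y) + Tr (k * f y) + Tr (k * k)"
      by (simp add: Q_def yk power2_eq_square algebra_simps flip: Tr_add)
    then show ?thesis
      using graph Tr_Kf Tr_KK yk(2) by simp
  qed
  have U_subspace: "plane.subspace U"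
  proof -
    have f_add: "f (x + y) = f x + f y" for x y
      by (simp add: f_def sig_add algebra_simps)
    have f_scale: "f (s * x) = s * f x" if "s \<in> Fp" for s x
      using that by (simp add: f_def sig_mult sig_Fp algebra_simps)
    have "0 \<in> U" 
      by (simp add: U_iff f_def K_def)
    moreover have "w + z \<in> U" if "w \<in> U" "z \<in> U" for w z
    proof -
      have "fst (w + z) - f (snd (w + z)) = (fst w - f (snd w)) + (fst z - f (snd z))"
        by (simp add: f_add)
      moreover have "a + b \<in> K" if "a \<in> K" "b \<in> K" for a b
        using that by (simp add: K_def sig_add algebra_simps)
      ultimately show ?thesis
        using that by (simp only: U_iff)
    qed
    moreover have "scale s z \<in> U" if "s \<in> Fp" "z \<in> U" for s z
    proof -
      have "fst (scale s z) - f (snd (scale s z)) = s * (fst z - f (snd z))"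
        using that by (simp add: scale_def f_scale algebra_simps)
      moreover have "s * a \<in> K" if "a \<in> K" for a
        using that \<open>s \<in> Fp\<close> by (simp add: K_def sig_mult sig_Fp mult.left_commute)
      ultimately show ?thesis
        using that by (simp only: U_iff)
    qed
    ultimately show ?thesis
      by (simp add: plane.subspace_def)
  qed
  have perp: "z \<in> U" if z: "\<And>w. w \<in> U \<Longrightarrow> B z w = 0" for z
  proof -
    \<comment> \<open>\<open>k\<close> is the deviation of \<open>z\<close> from the graph. Graph
      vectors are mutually orthogonal, so \<open>B z (f y, y)\<close> reduces to
      \<open>2 * Tr (k * f y)\<close>; hence \<open>k\<close> lies in the kernel of the
      adjoint.\<close>
    define k where "k = fst z - f (snd z)"
    have K0: "0 \<in> K"
      by (simp add: K_def)
    have "Tr (k * f y) = 0" for y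
    proof -
      have gU: "(f y, y) \<in> U" for y
        by (simp add: U_iff K0)
      have "B (f (snd z), snd z) (f y, y) = 0"
        using plane.Q_add[of "(f (snd z), snd z)" "(f y, y)"] isotropic[OF gU]
          isotropic[of "(f (snd z), snd z) + (f y, y)"] gU U_subspace
        by (simp add: plane.subspace_def del: add_Pair)
      moreover have "B z (f y, y) = B (f (snd z), snd z) (f y, y) + Tr (k * f y) + Tr (k * f y)"
        by (simp add: B_def k_def algebra_simps flip: Tr_add)
      ultimately have "2 * Tr (k * f y) = 0"
        using z[OF gU] by simp
      then show ?thesis using two_nonzero by simp
    qed
    then have "Tr ((sig k * sig \<alpha> + k * \<beta>) * sig y) = 0" for y
      by (simp add: f_adjoint)
    then have "Tr ((sig k * sig \<alpha> + k * \<beta>) * y) = 0" for y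
      using surj_sig by (metis surjD)
    then have "sig k * sig \<alpha> + k * \<beta> = 0"
      by (rule Tr_nondegenerate)
    then show ?thesis
      by (simp add: adjoint_K U_iff k_def)
  qed
  have "card U = card (UNIV \<times> K :: ('a \<times> 'a) set)"
    unfolding U_def by (rule card_image) (auto simp: inj_on_def)
  also have "\<dots> = p ^ (m + v)"
    by (simp add: card_cartesian_product card_UNIV_eq card_K power_add)
  finally show ?thesis
    using U_subspace isotropic perp by blast
qed

lemma card_UNIV_plane: "card (UNIV :: ('a \<times> 'a) set) = p ^ (2 * m)"
  by (simp add: card_cartesian_product card_UNIV_eq mult_2 power_add flip: UNIV_Times_UNIV)

lemma card_Q_level:
  assumes "c \<in> Fp"
  shows "p * card {z. Q z = c} + p ^ (m + v) = p ^ (2 * m) + (if c = 0 then p * p ^ (m + v) else 0)"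
proof -
  obtain U where U: "plane.subspace U" "\<forall>w\<in>U. Q w = 0"
    "\<forall>z. (\<forall>w\<in>U. B z w = 0) \<longrightarrow> z \<in> U" "card U = p ^ (m + v)"
    using ex_isotropic_subspace by blast
  have "card Fp * card {z. Q z = c} + card U
      = card (UNIV :: ('a \<times> 'a) set) + (if c = 0 then card Fp * card U else 0)"
    by (rule plane.card_level_isotropic) (use U assms in blast)+
  then show ?thesis
    by (simp only: card_UNIV_plane card_Fp U(4))
qed

lemma card_Q_zeros: "int p * int (card {z. Q z = 0}) = int p ^ (2 * m) + (int p - 1) * int p ^ (m + v)"
proof -
  have "int (p * card {z. Q z = 0} + p ^ (m + v)) = int (p ^ (2 * m) + p * p ^ (m + v))"
    using card_Q_level[of 0] Fp_closed(1) by simp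
  then show ?thesis
    by (simp add: algebra_simps)
qed

section \<open>Linear functionals and the map induced by the polar form\<close>

definition L :: "'a \<Rightarrow> 'a \<Rightarrow> 'a \<times> 'a \<Rightarrow> 'a" where
  "L a b z = Tr (a * fst z + b * snd z)"

lemma functional_L: "plane.functional (L a b)"
proof -
  have "L a b (scale s z) = s * L a b z" if "s \<in> Fp" for s z
    using Tr_mult_Fp[OF that, of "a * fst z + b * snd z"]
    by (simp add: L_def scale_def algebra_simps)
  then show ?thesis
    by (auto simp: plane.functional_def L_def Tr_Fp algebra_simps simp flip: Tr_add)
qed

lemma L_nondegenerate:
  assumes "(a, b) \<noteq> 0"
  shows "\<exists>z. L a b z \<noteq> 0"
proof (rule ccontr)
  assume "\<nexists>z. L a b z \<noteq> 0"
  then have *: "L a b z = 0" for z by blast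
  have "Tr (a * x) = 0" "Tr (b * x) = 0" for x
    using *[of "(x, 0)"] *[of "(0, x)"] by (auto simp: L_def)
  then have "a = 0" "b = 0"
    using Tr_nondegenerate by blast+
  then show False using assms by (simp add: zero_prod_def)
qed

definition isig :: "'a \<Rightarrow> 'a" where "isig = inv_into UNIV sig"

text \<open>The map \<open>n \<mapsto> B(n, _)\<close> from the plane to its dual, functionals being
  given by their coefficients as in \<open>L\<close>. The second coordinate arises because
  \<open>isig\<close> is the adjoint of \<open>sig\<close> for the trace form.\<close>

definition Phi :: "'a \<times> 'a \<Rightarrow> 'a \<times> 'a" where
  "Phi z = (2 * fst z, isig (snd z) + sig (snd z))"

lemma sig_isig [simp]: "sig (isig y) = y"
  using surj_sig by (simp add: isig_def surj_f_inv_f)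

lemma B_eq_L: "B z w = L (fst (Phi z)) (snd (Phi z)) w"
proof -
  have "Tr (snd z * sig (snd w)) = Tr (isig (snd z) * snd w)"
    using Tr_sig[of "isig (snd z) * snd w"] by (simp add: sig_mult)
  then show ?thesis
    by (simp add: B_def L_def Phi_def Tr_add algebra_simps)
qed

lemma Phi_add: "Phi (w + z) = Phi w + Phi z"
proof -
  have "isig (x + y) = isig x + isig y" for x y
    by (subst sig_eq_iff[symmetric]) (simp add: sig_add)
  then show ?thesis
    by (simp add: Phi_def sig_add algebra_simps)
qed

lemma Phi_eq_0: "Phi z = 0 \<longleftrightarrow> fst z = 0 \<and> snd z \<in> radical"
proof -
  have "isig y + sig y = 0 \<longleftrightarrow> sig (isig y + sig y) = sig 0" for y
    by (simp only: sig_eq_iff)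
  then have "isig y + sig y = 0 \<longleftrightarrow> y \<in> radical" for y
    by (simp add: sig_add radical_def eq_neg_iff_add_eq_0 add.commute)
  then show ?thesis
    using two_nonzero by (simp add: Phi_def zero_prod_def)
qed

lemma B_Phi_eq_0:
  assumes "Phi r = 0"
  shows "B r z = 0" "B z r = 0" "Q (z + r) = Q z"
proof -
  show *: "B r z = 0" for z
    using assms by (simp add: B_eq_L L_def)
  then show "B z r = 0"
    by (simp only: plane.B_commute[of z])
  moreover have "Q r = 0"
    using *[of r] plane.B_same[of r] two_nonzero by simp
  ultimately show "Q (z + r) = Q z"
    by (simp add: plane.Q_add)
qed

text \<open>The fibres of \<open>Phi\<close> are the cosets of its kernel
  \<open>{0} \<times> radical\<close>, and \<open>X\<close> is a union of such cosets.\<close>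

lemma card_Phi_image:
  assumes "\<And>z r. z \<in> X \<Longrightarrow> Phi r = 0 \<Longrightarrow> z + r \<in> X"
  shows "card X = p ^ (2 * v) * card (Phi ` X)"
proof -
  have "{r. Phi r = 0} = {0} \<times> radical"
    by (auto simp: Phi_eq_0)
  then have ker: "card {r. Phi r = 0} = p ^ (2 * v)"
    by (simp add: card_cartesian_product card_radical)
  have "card {z \<in> X. Phi z = y} = p ^ (2 * v)" if y: "y \<in> Phi ` X" for y
  proof -
    obtain z where z: "z \<in> X" "y = Phi z"
      using y by blast
    have "bij_betw ((+) z) {r. Phi r = 0} {w \<in> X. Phi w = y}"
    proof (rule bij_betw_byWitness[of _ "\<lambda>w. w - z"])
      have "Phi (w - z) = 0" if "Phi w = Phi z" for w
        using Phi_add[of "w - z" z] that by simp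
      then show "(\<lambda>w. w - z) ` {w \<in> X. Phi w = y} \<subseteq> {r. Phi r = 0}"
        using z by auto
      show "(+) z ` {r. Phi r = 0} \<subseteq> {w \<in> X. Phi w = y}"
        using z assms[OF z(1)] Phi_add[of z] by (simp add: image_subset_iff del: split_paired_All)
    qed auto
    from bij_betw_same_card[OF this] ker show ?thesis
      by linarith
  qed
  moreover have "card X = (\<Sum>y\<in>Phi ` X. card {z \<in> X. Phi z = y})"
    using sum.image_gen[of X "\<lambda>_. 1::nat" Phi] by simp
  ultimately show ?thesis by simp
qed

text \<open>Every \<open>B(n, _)\<close> vanishes on the radical, which gives one inclusion; both
  sides have \<open>p ^ (2 * m)\<close> over \<open>p ^ (2 * v)\<close> elements, by the size of the
  kernel and by \<open>card_perp\<close>.\<close>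

lemma range_Phi: "range Phi = UNIV \<times> {b. \<forall>r\<in>radical. Tr (b * r) = 0}"
proof (rule card_seteq)
  show "range Phi \<subseteq> UNIV \<times> {b. \<forall>r\<in>radical. Tr (b * r) = 0}"
  proof -
    have "Phi z \<in> (UNIV :: 'a set) \<times> {b. \<forall>r\<in>radical. Tr (b * r) = 0}" for z
    proof -
      have "Tr (snd (Phi z) * r) = 0" if "r \<in> radical" for r
        using B_Phi_eq_0(2)[of "(0, r)" z] that by (simp add: Phi_eq_0 B_eq_L L_def)
      then show ?thesis
        by (simp add: mem_Times_iff)
    qed
    then show ?thesis by blast
  qed
  have "p ^ (2 * v) * card (range Phi) = p ^ (2 * m)"
    using card_Phi_image[of UNIV] card_UNIV_plane by simp
  moreover have "p ^ (2 * v) * card ((UNIV :: 'a set) \<times> {b. \<forall>r\<in>radical. Tr (b * r) = 0}) = p ^ (2 * m)"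
    using card_perp[OF radical_subspace] card_radical
    by (simp add: card_cartesian_product card_UNIV_eq mult.left_commute mult_2 power_add)
  ultimately have "p ^ (2 * v) * card ((UNIV :: 'a set) \<times> {b. \<forall>r\<in>radical. Tr (b * r) = 0}) = p ^ (2 * v) * card (range Phi)"
    by simp
  then show "card ((UNIV :: 'a set) \<times> {b. \<forall>r\<in>radical. Tr (b * r) = 0}) \<le> card (range Phi)"
    using prime_gt_0_nat[OF prime_p] by simp
qed auto

section \<open>The weight of each functional\<close>

definition weight :: "'a \<times> 'a \<Rightarrow> nat" where
  "weight c = card {z. Q z = 0 \<and> L (fst c) (snd c) z \<noteq> 0}"

lemma weight_0: "weight 0 = 0"
  by (simp add: weight_def L_def)

lemma weight_complement: "weight c + card {z. Q z = 0 \<and> L (fst c) (snd c) z = 0} = card {z. Q z = 0}"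
  unfolding weight_def by (subst card_Un_disjoint[symmetric]) (auto intro: arg_cong[of _ _ card])

lemma weight_Phi_isotropic:
  assumes "Q n = 0" "Phi n \<noteq> 0"
  shows "int p ^ 2 * int (weight (Phi n)) = (int p - 1) * int p ^ (2 * m)"
proof -
  obtain w where "B n w \<noteq> 0"
    using L_nondegenerate[of "fst (Phi n)" "snd (Phi n)"] assms(2) by (auto simp: B_eq_L)
  then have "card Fp ^ 2 * card {z. Q z = 0 \<and> B n z \<noteq> 0} = (card Fp - 1) * card (UNIV :: ('a \<times> 'a) set)"
    using plane.card_zeros_perp_isotropic assms(1) by blast
  then have "p ^ 2 * weight (Phi n) = (p - 1) * p ^ (2 * m)"
    by (simp only: card_Fp card_UNIV_plane weight_def B_eq_L)
  then have "int (p ^ 2 * weight (Phi n)) = int ((p - 1) * p ^ (2 * m))"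
    by (simp only:)
  then show ?thesis
    using p_gt_2 by (simp add: of_nat_diff)
qed

lemma weight_Phi_anisotropic:
  assumes "Q n \<noteq> 0"
  shows "int p ^ 2 * int (weight (Phi n)) = (int p - 1) * (int p ^ (2 * m) + int p * int p ^ (m + v))"
proof -
  have level: "card {z. Q z = c} = (p ^ (2 * m) - p ^ (m + v)) div p" if "c \<in> Fp" "c \<noteq> 0" for c
  proof -
    have "p * card {z. Q z = c} = p ^ (2 * m) - p ^ (m + v)"
      using card_Q_level[OF that(1)] that(2) by simp
    from this[symmetric] show ?thesis
      using prime_gt_0_nat[OF prime_p] by simp
  qed
  have "card Fp ^ 2 * card {z. Q z = 0 \<and> B n z = 0} = card (UNIV :: ('a \<times> 'a) set)"
    by (rule plane.card_zeros_perp_anisotropic[OF assms level])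
  then have "p ^ 2 * card {z. Q z = 0 \<and> L (fst (Phi n)) (snd (Phi n)) z = 0} = p ^ (2 * m)"
    by (simp only: card_Fp card_UNIV_plane B_eq_L)
  then have perp: "int p ^ 2 * int (card {z. Q z = 0 \<and> L (fst (Phi n)) (snd (Phi n)) z = 0}) = int p ^ (2 * m)"
    by (simp flip: of_nat_mult of_nat_power)
  have "int (weight (Phi n)) = int (card {z. Q z = 0})
      - int (card {z. Q z = 0 \<and> L (fst (Phi n)) (snd (Phi n)) z = 0})"
    using weight_complement[of "Phi n"] by simp
  then have "int p ^ 2 * int (weight (Phi n)) = int p * (int p * int (card {z. Q z = 0})) - int p ^ (2 * m)"
    by (simp only: right_diff_distrib perp) (simp add: power2_eq_square)
  then show ?thesis
    unfolding card_Q_zeros by (simp add: algebra_simps)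
qed

text \<open>By \<open>range_Phi\<close> such a functional is nonzero at some radical vector. Shifts
  along that vector preserve the zeros of \<open>Q\<close>, so exactly one zero in \<open>p\<close>
  lies in the kernel of the functional.\<close>

lemma weight_not_Phi:
  assumes "c \<notin> range Phi"
  shows "int p ^ 2 * int (weight c) = (int p - 1) * (int p ^ (2 * m) + (int p - 1) * int p ^ (m + v))"
proof -
  obtain r where r: "r \<in> radical" "Tr (snd c * r) \<noteq> 0"
    using assms unfolding range_Phi by (cases c) auto
  have "card Fp * card {z \<in> {z. Q z = 0}. L (fst c) (snd c) z = 0} = card {z. Q z = 0}"
  proof (rule plane.card_functional_zeros_translate[OF functional_L])
    show "L (fst c) (snd c) (0, r) \<noteq> 0"
      using r by (simp add: L_def)
    have "line.subspace radical" by (rule radical_subspace)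
    then have "Phi (scale s (0, r)) = 0" if "s \<in> Fp" for s
      using that r by (simp add: Phi_eq_0 scale_def line.subspace_def)
    then show "z + scale s (0, r) \<in> {z. Q z = 0}" if "s \<in> Fp" "z \<in> {z. Q z = 0}" for s z
      using that B_Phi_eq_0(3) by simp
  qed
  then have "int p * int (card {z. Q z = 0 \<and> L (fst c) (snd c) z = 0}) = int (card {z. Q z = 0})"
    by (simp add: card_Fp flip: of_nat_mult)
  moreover have "int (weight c) = int (card {z. Q z = 0}) - int (card {z. Q z = 0 \<and> L (fst c) (snd c) z = 0})"
    using weight_complement[of c] by simp
  ultimately have "int p * int (weight c) = (int p - 1) * int (card {z. Q z = 0})"
    by (simp add: right_diff_distrib left_diff_distrib)
  then have "int p ^ 2 * int (weight c) = (int p - 1) * (int p * int (card {z. Q z = 0}))"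
    by (simp add: power2_eq_square mult.left_commute)
  then show ?thesis
    unfolding card_Q_zeros .
qed

section \<open>Sizes of the weight classes\<close>

lemma card_Phi_zeros:
  "int p ^ (2 * v + 1) * int (card (Phi ` {z. Q z = 0})) = int p ^ (2 * m) + (int p - 1) * int p ^ (m + v)"
proof -
  have "card {z. Q z = 0} = p ^ (2 * v) * card (Phi ` {z. Q z = 0})"
    by (rule card_Phi_image) (simp add: B_Phi_eq_0)
  then have "int (card {z. Q z = 0}) = int p ^ (2 * v) * int (card (Phi ` {z. Q z = 0}))"
    by simp
  then show ?thesis
    unfolding card_Q_zeros[symmetric] by simp
qed

text \<open>\<open>Q\<close> is constant on the fibres of \<open>Phi\<close>, so the two images are
  disjoint.\<close>

lemma card_Phi_nonzeros:
  "card (Phi ` {z. Q z = 0}) + card (Phi ` {z. Q z \<noteq> 0}) = card (range Phi)"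
proof -
  have "Phi ` {z. Q z = 0} \<inter> Phi ` {z. Q z \<noteq> 0} = {}"
  proof (rule equals0I)
    fix y assume "y \<in> Phi ` {z. Q z = 0} \<inter> Phi ` {z. Q z \<noteq> 0}"
    then obtain w z where "y = Phi w" "y = Phi z" "Q w = 0" "Q z \<noteq> 0"
      by blast
    then have wz: "Phi w = Phi z" "Q w = 0" "Q z \<noteq> 0"
      by simp_all
    then have "Phi (z - w) = 0"
      using Phi_add[of "z - w" w] by simp
    then have "Q (w + (z - w)) = Q w"
      by (rule B_Phi_eq_0)
    then show False using wz by simp
  qed
  then have "card (Phi ` {z. Q z = 0} \<union> Phi ` {z. Q z \<noteq> 0}) = card (Phi ` {z. Q z = 0}) + card (Phi ` {z. Q z \<noteq> 0})"
    by (intro card_Un_disjoint) auto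
  moreover have "Phi ` {z. Q z = 0} \<union> Phi ` {z. Q z \<noteq> 0} = range Phi"
    by auto
  ultimately show ?thesis by simp
qed

lemma card_range_Phi: "p ^ (2 * v) * card (range Phi) = p ^ (2 * m)"
  using card_Phi_image[of UNIV] card_UNIV_plane by simp

text \<open>\<open>w1\<close>, \<open>w2\<close> and \<open>w3\<close> are \<open>p ^ 2\<close>
  times the three nonzero weights, which keeps them integral polynomials in powers of
  \<open>p\<close>.\<close>

definition w1 :: int where "w1 = (int p - 1) * int p ^ (2 * m)"
definition w2 :: int where "w2 = (int p - 1) * (int p ^ (2 * m) + (int p - 1) * int p ^ (m + v))"
definition w3 :: int where "w3 = (int p - 1) * (int p ^ (2 * m) + int p * int p ^ (m + v))"

lemma w_less: "0 < w1" "w1 < w2" "w2 < w3"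
proof -
  have p: "int p - 1 > 0" "int p ^ (2 * m) > 0" "int p ^ (m + v) > 0"
    using p_gt_2 by simp_all
  then show "0 < w1"
    unfolding w1_def by (intro mult_pos_pos)
  have "int p ^ (2 * m) < int p ^ (2 * m) + (int p - 1) * int p ^ (m + v)"
    using mult_pos_pos[OF p(1,3)] by simp
  then show "w1 < w2"
    unfolding w1_def w2_def using p(1) by (rule mult_strict_left_mono)
  have "int p ^ (2 * m) + (int p - 1) * int p ^ (m + v) < int p ^ (2 * m) + int p * int p ^ (m + v)"
    using p(3) by (simp add: left_diff_distrib)
  then show "w2 < w3"
    unfolding w2_def w3_def using p(1) by (rule mult_strict_left_mono)
qed

text \<open>All exponents are written through \<open>1\<close>, \<open>2 * v\<close> and
  \<open>m - v - 1\<close>, which removes truncated subtraction and leaves polynomial identities.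
  The inequality \<open>4 * v \<le> m\<close> makes this legitimate.\<close>

lemma power_exponents:
  fixes x :: "'b::comm_semiring_1"
  shows "x ^ (2 * m) = x * x * x ^ (2 * v) * x ^ (m - v - 1) * x ^ (m - v - 1)"
    and "x ^ (2 * m - 2) = x ^ (2 * v) * x ^ (m - v - 1) * x ^ (m - v - 1)"
    and "x ^ (m + v) = x * x ^ (2 * v) * x ^ (m - v - 1)"
    and "x ^ (m - v) = x * x ^ (m - v - 1)"
    and "x ^ (2 * m - 2 * v) = x * x * x ^ (m - v - 1) * x ^ (m - v - 1)"
proof -
  define s where "s = m - v - 1"
  have "2 * m = 1 + 1 + 2 * v + s + s" "2 * m - 2 = 2 * v + s + s" "m + v = 1 + 2 * v + s"
    "m - v = 1 + s" "2 * m - 2 * v = 1 + 1 + s + s"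
    using v_le v_pos unfolding s_def by arith+
  then show "x ^ (2 * m) = x * x * x ^ (2 * v) * x ^ (m - v - 1) * x ^ (m - v - 1)"
    and "x ^ (2 * m - 2) = x ^ (2 * v) * x ^ (m - v - 1) * x ^ (m - v - 1)"
    and "x ^ (m + v) = x * x ^ (2 * v) * x ^ (m - v - 1)"
    and "x ^ (m - v) = x * x ^ (m - v - 1)"
    and "x ^ (2 * m - 2 * v) = x * x * x ^ (m - v - 1) * x ^ (m - v - 1)"
    unfolding s_def[symmetric] by (simp_all only: power_add power_one_right)
qed

text \<open>Together with \<open>{0}\<close> the three sets cover all functionals, and the values
  \<open>0\<close>, \<open>w1\<close>, \<open>w2\<close>, \<open>w3\<close> are distinct, so each
  implication from set to weight is an equivalence.\<close>

lemma weight_classes: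
  "{c. int p ^ 2 * int (weight c) = w1} = Phi ` {z. Q z = 0} - {0}"
  "{c. int p ^ 2 * int (weight c) = w2} = - range Phi"
  "{c. int p ^ 2 * int (weight c) = w3} = Phi ` {z. Q z \<noteq> 0}"
  and weight_eq_0: "weight c = 0 \<longleftrightarrow> c = 0"
proof -
  have 1: "int p ^ 2 * int (weight c) = w1" if "c \<in> Phi ` {z. Q z = 0} - {0}" for c
    using that weight_Phi_isotropic unfolding w1_def by blast
  have 2: "int p ^ 2 * int (weight c) = w2" if "c \<in> - range Phi" for c
    using that weight_not_Phi unfolding w2_def by blast
  have 3: "int p ^ 2 * int (weight c) = w3" if "c \<in> Phi ` {z. Q z \<noteq> 0}" for c
    using that weight_Phi_anisotropic unfolding w3_def by blast
  have 0: "int p ^ 2 * int (weight 0) = 0"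
    by (simp add: weight_0)
  have mem: "c = 0 \<or> c \<in> Phi ` {z. Q z = 0} - {0} \<or> c \<in> - range Phi \<or> c \<in> Phi ` {z. Q z \<noteq> 0}" for c
    by blast
  have ne: "w1 \<noteq> 0" "w2 \<noteq> 0" "w3 \<noteq> 0" "w1 \<noteq> w2" "w1 \<noteq> w3" "w2 \<noteq> w3"
    using w_less by linarith+
  define S1 S2 S3 where "S1 = Phi ` {z. Q z = 0} - {0}" and "S2 = - range Phi" and "S3 = Phi ` {z. Q z \<noteq> 0}"
  note S = S1_def[symmetric] S2_def[symmetric] S3_def[symmetric]
  have iff: "int p ^ 2 * int (weight c) = w1 \<longleftrightarrow> c \<in> Phi ` {z. Q z = 0} - {0}"
    "int p ^ 2 * int (weight c) = w2 \<longleftrightarrow> c \<in> - range Phi"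
    "int p ^ 2 * int (weight c) = w3 \<longleftrightarrow> c \<in> Phi ` {z. Q z \<noteq> 0}"
    "int p ^ 2 * int (weight c) = 0 \<longleftrightarrow> c = 0" for c
    using 0 1[of c] 2[of c] 3[of c] mem[of c] ne unfolding S by metis+
  show "{c. int p ^ 2 * int (weight c) = w1} = Phi ` {z. Q z = 0} - {0}"
    "{c. int p ^ 2 * int (weight c) = w2} = - range Phi"
    "{c. int p ^ 2 * int (weight c) = w3} = Phi ` {z. Q z \<noteq> 0}"
    unfolding iff by (simp_all only: Collect_mem_eq)
  show "weight c = 0 \<longleftrightarrow> c = 0"
    using iff(4)[of c] p_gt_2 by simp
qed

lemma card_weight_classes:
  defines "k \<equiv> int p ^ (m - v - 1)"
  shows "int (card {c. int p ^ 2 * int (weight c) = w1}) = (int p * k - 1) * (k + 1)"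
    "int (card {c. int p ^ 2 * int (weight c) = w2}) = int p ^ (2 * m) - int p ^ (2 * m - 2 * v)"
    "int (card {c. int p ^ 2 * int (weight c) = w3}) = (int p * k - 1) * k * (int p - 1)"
proof -
  have p0: "int p > 0"
    using p_gt_2 by simp
  have "int p ^ (2 * v + 1) * int (card (Phi ` {z. Q z = 0}))
      = int p ^ (2 * v + 1) * (int p * k * k + (int p - 1) * k)"
    unfolding card_Phi_zeros unfolding k_def power_exponents by (simp add: algebra_simps)
  \<comment> \<open>With \<open>h = m - v\<close> this is \<open>p^(2h-1) + p^h - p^(h-1)\<close>,
    the number of zeros of a hyperbolic form in dimension \<open>2h\<close>.\<close>
  then have zeros: "int (card (Phi ` {z. Q z = 0})) = int p * k * k + (int p - 1) * k"
    using p0 by simp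
  have "p ^ (2 * v) * card (range Phi) = p ^ (2 * v) * p ^ (2 * m - 2 * v)"
    unfolding card_range_Phi power_exponents by (simp only: mult_ac)
  then have rng: "card (range Phi) = p ^ (2 * m - 2 * v)"
    using p_gt_2 by simp
  \<comment> \<open>The zero functional belongs to the isotropic image and must be discounted, as
    its weight is \<open>0\<close>.\<close>
  have "0 \<in> Phi ` {z. Q z = 0}"
  proof (rule image_eqI)
    show "0 = Phi 0"
      by (simp add: Phi_eq_0 radical_def)
    show "0 \<in> {z. Q z = 0}"
      by (simp add: Q_def)
  qed
  from card.remove[OF _ this]
  have "int (card (Phi ` {z. Q z = 0} - {0})) = int (card (Phi ` {z. Q z = 0})) - 1"
    by simp
  then show "int (card {c. int p ^ 2 * int (weight c) = w1}) = (int p * k - 1) * (k + 1)"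
    unfolding weight_classes zeros by (simp add: algebra_simps)
  have "card (- range Phi) + card (range Phi) = p ^ (2 * m)"
    using card_Un_disjoint[of "- range Phi" "range Phi"] card_UNIV_plane by simp
  then have "int (card (- range Phi)) = int (p ^ (2 * m)) - int (p ^ (2 * m - 2 * v))"
    unfolding rng by linarith
  then show "int (card {c. int p ^ 2 * int (weight c) = w2}) = int p ^ (2 * m) - int p ^ (2 * m - 2 * v)"
    unfolding weight_classes by simp
  have "int (card (Phi ` {z. Q z \<noteq> 0})) = int p ^ (2 * m - 2 * v) - (int p * k * k + (int p - 1) * k)"
  proof -
    have "int (card (Phi ` {z. Q z = 0})) + int (card (Phi ` {z. Q z \<noteq> 0})) = int (p ^ (2 * m - 2 * v))"
      using card_Phi_nonzeros unfolding rng by (simp only: of_nat_add[symmetric])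
    then show ?thesis
      unfolding zeros by simp
  qed
  also have "int p ^ (2 * m - 2 * v) = int p * int p * k * k"
    unfolding k_def by (rule power_exponents)
  finally show "int (card {c. int p ^ 2 * int (weight c) = w3}) = (int p * k - 1) * k * (int p - 1)"
    unfolding weight_classes by (simp add: algebra_simps)
qed

section \<open>From functionals to codewords\<close>

lemma D2_eq: "D2 p m u = {z. Q z = 0} - {0}"
  by (auto simp: D2_def Q_def sig_def zero_prod_def)

lemma card_D2: "int (card (D2 p m u :: ('a \<times> 'a) set)) = int p ^ (2 * m - 1) + int p ^ (m + v) - int p ^ (m + v - 1) - 1"
proof -
  have "Q 0 = 0"
    by (simp add: Q_def)
  then have "int (card (D2 p m u :: ('a \<times> 'a) set)) = int (card {z. Q z = 0}) - 1"
    using card.remove[of "{z. Q z = 0}" 0] by (simp add: D2_eq)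
  moreover have "2 * m = Suc (2 * m - 1)" "m + v = Suc (m + v - 1)"
    using m_pos by arith+
  then have "int p ^ (2 * m) = int p * int p ^ (2 * m - 1)" "int p ^ (m + v) = int p * int p ^ (m + v - 1)"
    by (metis power_Suc)+
  then have "int p * int (card {z. Q z = 0}) = int p * (int p ^ (2 * m - 1) + int p ^ (m + v) - int p ^ (m + v - 1))"
    unfolding card_Q_zeros by (simp add: algebra_simps)
  then have "int (card {z. Q z = 0}) = int p ^ (2 * m - 1) + int p ^ (m + v) - int p ^ (m + v - 1)"
    using p_gt_2 by simp
  ultimately show ?thesis by simp
qed

definition cw :: "'a \<times> 'a \<Rightarrow> 'a \<times> 'a \<Rightarrow> 'a" where
  "cw c = codeword p m (D2 p m u) (fst c) (snd c)"

lemma code_eq: "code p m (D2 p m u :: ('a \<times> 'a) set) = range cw"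
proof
  show "code p m (D2 p m u) \<subseteq> range cw"
  proof
    fix c :: "'a \<times> 'a \<Rightarrow> 'a" assume "c \<in> code p m (D2 p m u)"
    then obtain a b where "c = cw (a, b)"
      by (auto simp: code_def cw_def)
    then show "c \<in> range cw" by blast
  qed
  show "range cw \<subseteq> code p m (D2 p m u)"
    unfolding code_def cw_def[abs_def] by blast
qed

lemma cw_apply: "z \<in> D2 p m u \<Longrightarrow> cw c z = L (fst c) (snd c) z"
  by (simp add: cw_def codeword_def L_def)

text \<open>\<open>weight\<close> also ranges over the origin, which is absent from
  \<open>D2\<close>; functionals vanish there, so the counts agree.\<close>

lemma hamming_wt_cw: "hamming_wt (D2 p m u) (cw c) = weight c"
proof -
  have "z \<in> D2 p m u \<and> cw c z \<noteq> 0 \<longleftrightarrow> Q z = 0 \<and> L (fst c) (snd c) z \<noteq> 0" for z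
  proof (cases "z \<in> D2 p m u")
    case True
    then show ?thesis
      using cw_apply[OF True, of c] by (simp add: D2_eq)
  next
    case False
    then have "Q z = 0 \<longrightarrow> z = 0"
      by (simp add: D2_eq)
    then show ?thesis
      using False by (auto simp: L_def)
  qed
  then show ?thesis
    by (simp only: hamming_wt_def weight_def)
qed

text \<open>If two codewords agree, their difference functional has weight \<open>0\<close>, and
  only the zero functional has. This yields the dimension \<open>2 * m\<close>.\<close>

lemma inj_cw: "inj cw"
proof (rule injI)
  fix c d assume eq: "cw c = cw d"
  have "L (fst (c - d)) (snd (c - d)) z = 0" if z: "Q z = 0" for z
  proof (cases "z = 0")
    case False
    then have "L (fst c) (snd c) z = L (fst d) (snd d) z"
      using eq z cw_apply[of z c] cw_apply[of z d] by (simp add: D2_eq)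
    then show ?thesis
      by (simp add: L_def left_diff_distrib Tr_add Tr_diff algebra_simps)
  qed (simp add: L_def)
  then have "weight (c - d) = 0"
    by (auto simp: weight_def)
  then show "c = d"
    by (simp add: weight_eq_0)
qed

lemma cw_0: "cw c = (\<lambda>z\<in>D2 p m u. 0) \<longleftrightarrow> c = 0"
proof -
  have "cw 0 = (\<lambda>z\<in>D2 p m u. 0)"
    by (simp add: cw_def codeword_def)
  then show ?thesis
    using inj_cw by (metis injD)
qed

lemma card_code_class:
  "card {c \<in> code p m (D2 p m u :: ('a \<times> 'a) set). P (hamming_wt (D2 p m u) c)} = card {c. P (weight c)}"
proof -
  have "{c \<in> code p m (D2 p m u). P (hamming_wt (D2 p m u) c)} = cw ` {c. P (weight c)}"
    unfolding code_eq using hamming_wt_cw by auto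
  then show ?thesis
    by (simp only: card_image[OF inj_on_subset[OF inj_cw subset_UNIV]])
qed

end

theorem theorem6:
  fixes p m u :: nat
  assumes "prime p" and "odd p" and "m > 0" and "u > 0"
    and "card (UNIV :: 'a::{finite,field} set) = p ^ m"
    and "(m div gcd m u) mod 4 = 0"
  shows "let v = gcd m u;
             D = (D2 p m u :: ('a \<times> 'a) set);
             C = code p m D;
             wt = (\<lambda>c. real (hamming_wt D c));
             W1 = real (p - 1) * real p ^ (2 * m - 2);
             W2 = real (p - 1) * real p ^ (2 * m - 2) * (1 + real (p - 1) / real p ^ (m - v));
             W3 = real (p - 1) * real p ^ (2 * m - 2) * (1 + 1 / real p ^ (m - v - 1))
         in int (card D) = int p ^ (2 * m - 1) + int p ^ (m + v) - int p ^ (m + v - 1) - 1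
          \<and> card C = p ^ (2 * m)
          \<and> card {W1, W2, W3} = 3
          \<and> wt ` {c \<in> C. c \<noteq> (\<lambda>z\<in>D. 0)} = {W1, W2, W3}
          \<and> card {c \<in> C. hamming_wt D c = 0} = 1
          \<and> int (card {c \<in> C. wt c = W1}) = (int p ^ (m - v) - 1) * (int p ^ (m - v - 1) + 1)
          \<and> int (card {c \<in> C. wt c = W2}) = int p ^ (2 * m) - int p ^ (2 * m - 2 * v)
          \<and> int (card {c \<in> C. wt c = W3}) = (int p ^ (m - v) - 1) * int p ^ (m - v - 1) * (int p - 1)"
proof -
  interpret trace_code p m "TYPE('a)" u
    by standard (use assms in auto)
  define D where "D = (D2 p m u :: ('a \<times> 'a) set)"
  define W1 where "W1 = real (p - 1) * real p ^ (2 * m - 2)"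
  define W2 where "W2 = real (p - 1) * real p ^ (2 * m - 2) * (1 + real (p - 1) / real p ^ (m - v))"
  define W3 where "W3 = real (p - 1) * real p ^ (2 * m - 2) * (1 + 1 / real p ^ (m - v - 1))"
  have p0: "real p > 0" and p1: "real (p - 1) = real p - 1"
    using p_gt_2 by (auto simp: of_nat_diff)
  have W: "real p ^ 2 * W1 = real_of_int w1" "real p ^ 2 * W2 = real_of_int w2"
    "real p ^ 2 * W3 = real_of_int w3"
    unfolding W1_def W2_def W3_def w1_def w2_def w3_def p1 power_exponents
    using p0 by (simp_all add: field_simps power2_eq_square)
  have W_iff: "real n = W1 \<longleftrightarrow> int p ^ 2 * int n = w1" "real n = W2 \<longleftrightarrow> int p ^ 2 * int n = w2"
    "real n = W3 \<longleftrightarrow> int p ^ 2 * int n = w3" for n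
  proof -
    have "real n = x \<longleftrightarrow> int p ^ 2 * int n = y" if "real p ^ 2 * x = real_of_int y" for x y
    proof -
      have "real n = x \<longleftrightarrow> real p ^ 2 * real n = real p ^ 2 * x"
        using p0 by simp
      also have "\<dots> \<longleftrightarrow> real_of_int (int p ^ 2 * int n) = real_of_int y"
        by (simp add: that)
      finally show ?thesis
        by (simp only: of_int_eq_iff)
    qed
    then show "real n = W1 \<longleftrightarrow> int p ^ 2 * int n = w1" "real n = W2 \<longleftrightarrow> int p ^ 2 * int n = w2"
      "real n = W3 \<longleftrightarrow> int p ^ 2 * int n = w3"
      using W by blast+
  qed
  have W_ne: "W1 \<noteq> W2" "W1 \<noteq> W3" "W2 \<noteq> W3"
    using W w_less by auto
  have classes: "int (card {c \<in> code p m D. real (hamming_wt D c) = W1}) = (int p ^ (m - v) - 1) * (int p ^ (m - v - 1) + 1)"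
    "int (card {c \<in> code p m D. real (hamming_wt D c) = W2}) = int p ^ (2 * m) - int p ^ (2 * m - 2 * v)"
    "int (card {c \<in> code p m D. real (hamming_wt D c) = W3}) = (int p ^ (m - v) - 1) * int p ^ (m - v - 1) * (int p - 1)"
    using card_weight_classes card_code_class[of "\<lambda>n. int p ^ 2 * int n = w1"]
      card_code_class[of "\<lambda>n. int p ^ 2 * int n = w2"] card_code_class[of "\<lambda>n. int p ^ 2 * int n = w3"]
    by (simp_all add: W_iff D_def power_exponents(4))
  have zero: "card {c \<in> code p m D. hamming_wt D c = 0} = 1"
    using card_code_class[of "\<lambda>n. n = 0"] by (simp add: D_def weight_eq_0)
  have card_C: "card (code p m D) = p ^ (2 * m)"
    unfolding D_def code_eq by (simp add: card_image[OF inj_cw] card_UNIV_plane)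
  have "(\<lambda>c. real (hamming_wt D c)) ` {c \<in> code p m D. c \<noteq> (\<lambda>z\<in>D. 0)} = {W1, W2, W3}"
  proof
    show "(\<lambda>c. real (hamming_wt D c)) ` {c \<in> code p m D. c \<noteq> (\<lambda>z\<in>D. 0)} \<subseteq> {W1, W2, W3}"
    proof -
      have "real (weight c) \<in> {W1, W2, W3}" if "c \<noteq> 0" for c :: "'a \<times> 'a"
      proof -
        have "c \<in> Phi ` {z. Q z = 0} - {0} \<union> - range Phi \<union> Phi ` {z. Q z \<noteq> 0}"
          using that by blast
        then show ?thesis
          unfolding weight_classes[symmetric] by (simp add: W_iff)
      qed
      then have "real (hamming_wt (D2 p m u) (cw c)) \<in> {W1, W2, W3}" if "cw c \<noteq> (\<lambda>z\<in>D2 p m u. 0)" for c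
        using that by (simp only: hamming_wt_cw cw_0 not_False_eq_True)
      then show ?thesis
        unfolding D_def code_eq by blast
    qed
    \<comment> \<open>Each weight occurs because its multiplicity is positive: the first and third
      need \<open>m > v\<close>, the second \<open>v > 0\<close>.\<close>
    have pos: "int p ^ (m - v) > 1" "int p ^ (m - v - 1) > 0" "int p ^ (2 * m) > int p ^ (2 * m - 2 * v)" "int p > 1"
      using p_gt_2 v_pos m_pos v_le by (auto intro!: one_less_power power_strict_increasing)
    have ex: "W \<in> (\<lambda>c. real (hamming_wt D c)) ` {c \<in> code p m D. c \<noteq> (\<lambda>z\<in>D. 0)}"
      if card: "int (card {c \<in> code p m D. real (hamming_wt D c) = W}) > 0" and W: "W \<noteq> 0" for W
    proof -
      obtain c where c: "c \<in> code p m D" "real (hamming_wt D c) = W"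
        using card by (auto simp: card_gt_0_iff)
      moreover have "c \<noteq> (\<lambda>z\<in>D. 0)"
        using c(2) W by (auto simp: hamming_wt_def cong: conj_cong)
      ultimately show ?thesis by blast
    qed
    have W0: "W1 \<noteq> 0" "W2 \<noteq> 0" "W3 \<noteq> 0"
      using W w_less by auto
    show "{W1, W2, W3} \<subseteq> (\<lambda>c. real (hamming_wt D c)) ` {c \<in> code p m D. c \<noteq> (\<lambda>z\<in>D. 0)}"
      using ex[of W1] ex[of W2] ex[of W3] pos W0 unfolding classes by simp
  qed
  moreover have "card {W1, W2, W3} = 3"
    using W_ne by simp
  ultimately show ?thesis
    using card_D2 card_C zero classes
    unfolding Let_def D_def W1_def W2_def W3_def v_def by (intro conjI)
qed

end
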